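(* Let $(K;\mathcal{T})$ be a triangulated 3-dimensional pseudo-manifold (with or without boundary), and let $(A,\kappa)$ be prescribed area-curvature functions. Then $(K;\mathcal{T})$ admits a generalised angle structure with area-curvature $(A,\kappa)$ if and only if for each vertex linking normal surface $S$, $$\chi(S)=\chi^{(A,\kappa)}(\overline{S}).$$ If it is non-empty, then the set of all generalised angle structures with area-curvature $(A,\kappa)$ is an affine space of dimension $2t-n+v$, where $v$ is the number of vertices, $n$ the number of edges and $t$ the number of tetrahedra in $\mathcal{T}$.
   Context: **Pseudo-manifolds.** Let $X$ be a disjoint union of compact 3-simplices $\sigma^3_1,\dots,\sigma^3_t$ and $\Phi=\{\phi_1,\dots,\phi_r\}$ a collection of affine isomorphisms $\phi_i:\tau_i\to\delta_i$ between distinct codimension-one faces of the simplices, with $\{\tau_i,\delta_i\}\cap\{\tau_j,\delta_j\}=\emptyset$ for $i\ne j$. The quotient $K=X/\Phi$ is a compact 3-dimensional pseudo-manifold and the images of the simplices and their sub-simplices form its triangulation $\mathcal{T}$, with cells called vertices, edges, triangles, tetrahedra. It has boundary (the images of unpaired faces) if some face is unpaired; otherwise it is closed. Let $e_1,\dots,e_n$ be the edges. **Normal disc types.** A normal disc in a tetrahedron is a properly embedded disc meeting each face in one normal arc (a properly embedded arc joining the interiors of two distinct edges of the face) or not at all. Up to normal isotopy (isotopy preserving each cell) each tetrahedron has four normal triangle types (each cutting off a corner and meeting the three edges there) and three normal quadrilateral types (each separating a pair of opposite edges and meeting the other four edges). A quadrilateral type faces the two edges of its tetrahedron disjoint from it.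 Let $N_\square=\{q_1,\dots,q_{3t}\}$ and $N_\Delta=\{p_1,\dots,p_{4t}\}$ be the sets of all quadrilateral and triangle types in $\mathcal{T}$. Identify these types with the standard basis vectors of $\mathbb{R}^{7t}$ (quadrilaterals first). For a normal surface $S$ (a compact surface whose preimage in $X$ is a finite collection of normal discs), its normal coordinate $\overline{S}\in\mathbb{R}^{7t}$ counts the discs of each type. The vertex linking normal surface of a vertex of $\mathcal{T}$ is the normal surface consisting of exactly one normal triangle for each tetrahedron corner at that vertex. **Solution space.** $C(K;\mathcal{T})\subset\mathbb{R}^{7t}$ is the vector space of all $(x_1,\dots,x_{3t},y_1,\dots,y_{4t})$ satisfying, for each pairing $\phi:\tau\to\delta$ in $\Phi$ (with $\tau\subset\sigma^3_i$, $\delta\subset\sigma^3_j$) and each normal arc type in the resulting triangle, $x_q+y_p=x_{q'}+y_{p'}$, where $q,p$ are the quadrilateral and triangle types in $\sigma^3_i$ meeting $\tau$ in that arc type and $q',p'$ those in $\sigma^3_j$ meeting $\delta$ in that arc type. For $s\in C(K;\mathcal{T})$ let $y_p(s)$ be its coordinate at the triangle type $p$. For each tetrahedron $\sigma^3$, $W_{\sigma^3}$ is the sum of its four triangle types minus the sum of its three quadrilateral types. For each edge $e$ of degree $k$ (formed by gluing $k$ edges $\tilde e_1,\dots,\tilde e_k$ of the unglued tetrahedra), $W_e=\sum_{i=1}^k(p_{s_i}+p_{r_i}-q_{l_i})$, where in the tetrahedron containing $\tilde e_i$, $q_{l_i}$ is the quadrilateral type disjoint from $\tilde e_i$ and $p_{s_i},p_{r_i}$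 are the two triangle types meeting $\tilde e_i$. By a theorem of Kang and Rubinstein, $W_{\sigma^3_1},\dots,W_{\sigma^3_t},W_{e_1},\dots,W_{e_n}$ is a basis of $C(K;\mathcal{T})$. **Angle structures with area-curvature $(A,\kappa)$.** A quadrilateral disc separates the interior of a 3-simplex into two wedges; up to normal isotopy there are six wedges in each 3-simplex, one for each edge of it. A generalised angle structure on $(K;\mathcal{T})$ is a real-valued function on the set of all wedges (of all tetrahedra). The combinatorial area of a triangle type is the sum of the angles of the three wedges at the three edges it meets, minus $\pi$. The curvature at an edge $e$ is $2\pi$ (if the interior of $e$ lies in the interior of $K$) or $\pi$ (if $e\subset\partial K$) minus the sum of the angles of all wedges containing $e$. Prescribed area-curvature functions $(A,\kappa)$ are functions $A:N_\Delta\to\mathbb{R}$ and $\kappa:\{\text{edges}\}\to\mathbb{R}$; a generalised angle structure with area-curvature $(A,\kappa)$ is one whose areas of normal triangle types and curvatures at edges are given by $A$ and $\kappa$. **The function $\chi^{(A,\kappa)}$.** It is the linear function on $C(K;\mathcal{T})$ given, for $s=\sum_{i=1}^t w_iW_{\sigma^3_i}+\sum_{j=1}^n z_jW_{e_j}$, by $\chi^{(A,\kappa)}(s)=\frac1{2\pi}\Big(\sum_{p\in N_\Delta}y_p(s)A(p)+\sum_{j=1}^n 2z_j\kappa(e_j)\Big)$. $\chi(S)$ is the usual Euler characteristic.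
   Formalization: The formal theorem additionally assumes that no edge is identified with itself by an orientation-reversing map; with such an edge the stated equivalence fails, since the condition needed at its end vertex is no longer that the two Euler characteristics agree. *)

theory Defs
  imports "HOL-Analysis.Analysis"
begin

text \<open>
  The vertices of a tetrahedron are the four elements of the type \<open>4\<close>. The face opposite the
  vertex \<open>f\<close> is denoted by \<open>f\<close>, and the normal triangle type cutting off the corner at \<open>v\<close>
  by \<open>v\<close>. An edge is the set of its two end points; it also stands for the wedge containing it.
  A quadrilateral type is the partition of the vertices into the two edges that it separates.
\<close>

typedef tedge = "{e :: 4 set. card e = 2}" morphisms ends Abs_tedge
  by (rule exI[of _ "{0, 1}"]) simp

typedef tquad = "{{e, - e} | e :: 4 set. card e = 2}" morphisms sides Abs_tquad
  by (rule exI[of _ "{{0, 1}, - {0, 1}}"]) (auto intro!: exI[of _ "{0, 1}"])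

instance tedge :: finite
proof
  have "inj ends" by (simp add: inj_on_def ends_inject)
  then show "finite (UNIV :: tedge set)" by (rule finite_imageD[rotated]) simp
qed

instance tquad :: finite
proof
  have "inj sides" by (simp add: inj_on_def sides_inject)
  then show "finite (UNIV :: tquad set)" by (rule finite_imageD[rotated]) simp
qed

definition edge_between :: "4 \<Rightarrow> 4 \<Rightarrow> tedge"
  where "edge_between a b = Abs_tedge {a, b}"

definition map_edge :: "(4 \<Rightarrow> 4) \<Rightarrow> tedge \<Rightarrow> tedge"
  where "map_edge g e = Abs_tedge (g ` ends e)"

definition quad_facing :: "tedge \<Rightarrow> tquad"
  where "quad_facing e = Abs_tquad {ends e, - ends e}"


text \<open>
  The tetrahedra are indexed by a finite type. An affine isomorphism between two faces is
  determined by its action on vertices, and a bijection between the vertices of the faces \<open>f\<close>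
  and \<open>f'\<close> has a unique extension to a permutation \<open>g\<close> of the type \<open>4\<close> with \<open>g f = f'\<close>. So
  \<open>(i, f, j, g)\<close> is the pairing of face \<open>f\<close> of tetrahedron \<open>i\<close> with face \<open>g f\<close> of tetrahedron \<open>j\<close>
  that sends each vertex \<open>v \<noteq> f\<close> to \<open>g v\<close>.
\<close>

type_synonym 't pairing = "'t \<times> 4 \<times> 't \<times> (4 \<Rightarrow> 4)"

fun paired_faces :: "'t pairing \<Rightarrow> ('t \<times> 4) set"
  where "paired_faces (i, f, j, g) = {(i, f), (j, g f)}"

definition equiv_closure :: "('a \<times> 'a) set \<Rightarrow> ('a \<times> 'a) set"
  where "equiv_closure r = (r \<union> r\<inverse>)\<^sup>*"

definition corner_equiv :: "'t pairing set \<Rightarrow> (('t \<times> 4) \<times> ('t \<times> 4)) set"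
  where "corner_equiv \<Phi> = equiv_closure
    {((i, v), (j, g v)) | i f j g v. (i, f, j, g) \<in> \<Phi> \<and> v \<noteq> f}"

definition edge_equiv :: "'t pairing set \<Rightarrow> (('t \<times> tedge) \<times> ('t \<times> tedge)) set"
  where "edge_equiv \<Phi> = equiv_closure
    {((i, e), (j, map_edge g e)) | i f j g e. (i, f, j, g) \<in> \<Phi> \<and> f \<notin> ends e}"

text \<open>\<open>(i, a, b)\<close> is the edge from \<open>a\<close> to \<open>b\<close> of tetrahedron \<open>i\<close>, with that orientation.\<close>

definition oriented_edge_equiv :: "'t pairing set \<Rightarrow> (('t \<times> 4 \<times> 4) \<times> ('t \<times> 4 \<times> 4)) set"
  where "oriented_edge_equiv \<Phi> = equiv_closure
    {((i, a, b), (j, g a, g b)) | i f j g a b. (i, f, j, g) \<in> \<Phi> \<and> a \<noteq> f \<and> b \<noteq> f \<and> a \<noteq> b}"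

text \<open>
  The last condition says that no edge is identified with itself by an orientation reversing map,
  so that the quotient map is injective on the interior of every edge and the images of the edges
  are again edges. On interiors of triangles and tetrahedra injectivity is automatic.
\<close>

definition triangulated_pseudomanifold :: "'t pairing set \<Rightarrow> bool"
  where "triangulated_pseudomanifold \<Phi> \<longleftrightarrow>
    (\<forall>(i, f, j, g) \<in> \<Phi>. bij g \<and> (i, f) \<noteq> (j, g f)) \<and>
    pairwise (\<lambda>\<phi> \<psi>. paired_faces \<phi> \<inter> paired_faces \<psi> = {}) \<Phi> \<and>
    (\<forall>i a b. a \<noteq> b \<longrightarrow> ((i, a, b), (i, b, a)) \<notin> oriented_edge_equiv \<Phi>)"

definition vertices :: "'t pairing set \<Rightarrow> ('t \<times> 4) set set"
  where "vertices \<Phi> = UNIV // corner_equiv \<Phi>"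

definition edges :: "'t pairing set \<Rightarrow> ('t \<times> tedge) set set"
  where "edges \<Phi> = UNIV // edge_equiv \<Phi>"

definition unpaired_face :: "'t pairing set \<Rightarrow> 't \<times> 4 \<Rightarrow> bool"
  where "unpaired_face \<Phi> F \<longleftrightarrow> F \<notin> (\<Union>\<phi>\<in>\<Phi>. paired_faces \<phi>)"

definition boundary_edge :: "'t pairing set \<Rightarrow> ('t \<times> tedge) set \<Rightarrow> bool"
  where "boundary_edge \<Phi> E \<longleftrightarrow> (\<exists>(i, e) \<in> E. \<exists>f. f \<notin> ends e \<and> unpaired_face \<Phi> (i, f))"


type_synonym 't disc_type = "('t \<times> tquad) + ('t \<times> 4)"

abbreviation quad_vec :: "'t::finite \<times> tquad \<Rightarrow> real ^ 't disc_type"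
  where "quad_vec q \<equiv> axis (Inl q) 1"

abbreviation tri_vec :: "'t::finite \<times> 4 \<Rightarrow> real ^ 't disc_type"
  where "tri_vec p \<equiv> axis (Inr p) 1"

text \<open>
  The normal arc types in face \<open>f\<close> correspond to the vertices \<open>v \<noteq> f\<close> that they cut off. A
  quadrilateral meets face \<open>f\<close> in the arc cutting off \<open>v\<close> iff it separates \<open>v\<close> from the other two
  vertices of the face, i.e. iff it separates the edge joining \<open>f\<close> and \<open>v\<close> from its opposite.
\<close>

definition arc_weight :: "real ^ ('t::finite) disc_type \<Rightarrow> 't \<Rightarrow> 4 \<Rightarrow> 4 \<Rightarrow> real"
  where "arc_weight s i f v = s $ Inl (i, quad_facing (edge_between f v)) + s $ Inr (i, v)"

definition solution_space :: "('t::finite) pairing set \<Rightarrow> (real ^ 't disc_type) set"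
  where "solution_space \<Phi> =
    {s. \<forall>(i, f, j, g) \<in> \<Phi>. \<forall>v. v \<noteq> f \<longrightarrow> arc_weight s i f v = arc_weight s j (g f) (g v)}"

definition W_tet :: "'t::finite \<Rightarrow> real ^ 't disc_type"
  where "W_tet i = (\<Sum>v\<in>UNIV. tri_vec (i, v)) - (\<Sum>q\<in>UNIV. quad_vec (i, q))"

definition W_edge :: "('t::finite \<times> tedge) set \<Rightarrow> real ^ 't disc_type"
  where "W_edge E = (\<Sum>(i, e)\<in>E. (\<Sum>v\<in>ends e. tri_vec (i, v)) - quad_vec (i, quad_facing e))"


type_synonym 't angles = "real ^ ('t \<times> tedge)"

definition area :: "('t::finite) angles \<Rightarrow> 't \<times> 4 \<Rightarrow> real"
  where "area \<theta> = (\<lambda>(i, v). (\<Sum>e | v \<in> ends e. \<theta> $ (i, e)) - pi)"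

definition curvature :: "('t::finite) pairing set \<Rightarrow> 't angles \<Rightarrow> ('t \<times> tedge) set \<Rightarrow> real"
  where "curvature \<Phi> \<theta> E = (if boundary_edge \<Phi> E then pi else 2 * pi) - (\<Sum>w\<in>E. \<theta> $ w)"

definition angle_structures ::
  "('t::finite) pairing set \<Rightarrow> ('t \<times> 4 \<Rightarrow> real) \<Rightarrow> (('t \<times> tedge) set \<Rightarrow> real) \<Rightarrow> 't angles set"
  where "angle_structures \<Phi> A \<kappa> =
    {\<theta>. (\<forall>p. area \<theta> p = A p) \<and> (\<forall>E\<in>edges \<Phi>. curvature \<Phi> \<theta> E = \<kappa> E)}"

text \<open>
  The description is unique because the vectors \<open>W_tet i\<close> and \<open>W_edge E\<close> form a basis of the
  solution space (Kang and Rubinstein).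
\<close>

definition chi_area_curvature ::
  "('t::finite) pairing set \<Rightarrow> ('t \<times> 4 \<Rightarrow> real) \<Rightarrow> (('t \<times> tedge) set \<Rightarrow> real)
    \<Rightarrow> real ^ 't disc_type \<Rightarrow> real"
  where "chi_area_curvature \<Phi> A \<kappa> = (\<lambda>s \<in> solution_space \<Phi>.
    THE r. \<exists>w z. s = (\<Sum>i\<in>UNIV. w i *\<^sub>R W_tet i) + (\<Sum>E\<in>edges \<Phi>. z E *\<^sub>R W_edge E) \<and>
      r = 1 / (2 * pi) * ((\<Sum>p\<in>UNIV. s $ Inr p * A p) + (\<Sum>E\<in>edges \<Phi>. 2 * z E * \<kappa> E)))"


text \<open>
  The vertex linking surface of \<open>x\<close> consists of the triangles at the corners in \<open>x\<close>, glued by the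
  face pairings. These form a cell decomposition: the side of the triangle at \<open>v\<close> lying in face
  \<open>f\<close> of tetrahedron \<open>i\<close> is \<open>(i, f, v)\<close>, and its corner on the edge from \<open>v\<close> to \<open>b\<close> is
  \<open>(i, v, b)\<close>, the same data as an oriented edge.
\<close>

definition arc_equiv :: "'t pairing set \<Rightarrow> (('t \<times> 4 \<times> 4) \<times> ('t \<times> 4 \<times> 4)) set"
  where "arc_equiv \<Phi> = equiv_closure
    {((i, f, v), (j, g f, g v)) | i f j g v. (i, f, j, g) \<in> \<Phi> \<and> v \<noteq> f}"

definition link_points :: "'t pairing set \<Rightarrow> ('t \<times> 4) set \<Rightarrow> ('t \<times> 4 \<times> 4) set set"
  where "link_points \<Phi> x = {(i, v, b). (i, v) \<in> x \<and> b \<noteq> v} // oriented_edge_equiv \<Phi>"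

definition link_arcs :: "'t pairing set \<Rightarrow> ('t \<times> 4) set \<Rightarrow> ('t \<times> 4 \<times> 4) set set"
  where "link_arcs \<Phi> x = {(i, f, v). (i, v) \<in> x \<and> f \<noteq> v} // arc_equiv \<Phi>"

definition link_euler_char :: "'t pairing set \<Rightarrow> ('t \<times> 4) set \<Rightarrow> int"
  where "link_euler_char \<Phi> x =
    int (card (link_points \<Phi> x)) - int (card (link_arcs \<Phi> x)) + int (card x)"

definition link_coord :: "('t::finite \<times> 4) set \<Rightarrow> real ^ 't disc_type"
  where "link_coord x = (\<Sum>p\<in>x. tri_vec p)"

end

theory Submission
  imports Defs
begin

text \<open>
  Prescribing the areas of all triangle types and the curvatures of all edges is a linear system in the
  \<open>6 * t\<close> angles, with one equation for each of the \<open>4 * t\<close> corners and one for each of the \<open>n\<close> edges. Such a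
  system is solvable iff every linear relation among the left-hand sides also holds for the right-hand
  sides, so the proof consists in finding all relations and evaluating them.

  The angle at the edge \<open>ab\<close> of a tetrahedron occurs in the equations of the corners \<open>a\<close> and \<open>b\<close> and of the edge
  class of \<open>ab\<close>. A relation with corner coefficients \<open>y\<close> therefore has edge coefficients \<open>-(y a + y b)\<close>, and
  the only condition on \<open>y\<close> is that \<open>y a + y b\<close> agrees for identified edges. Looking at the three edges of a
  glued triangle, this forces \<open>y\<close> itself to agree at identified corners. So the relations are the functions
  on the vertices of the complex (\<open>row_dependencies_eq\<close>): they form a space of dimension \<open>v\<close>, and the
  solution set, if it is not empty, has dimension \<open>6 * t - (4 * t + n - v)\<close>.

  It remains to evaluate the relation of a single vertex \<open>x\<close>, for which \<open>y\<close> is the indicator function of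
  the corners at \<open>x\<close>. Two facts show that it amounts to the asserted equation
  (\<open>vertex_dependency_defect\<close>). First, the link of \<open>x\<close> is the combination of the vectors \<open>W\<close> in which
  \<open>W_edge\<close> has coefficient \<open>(y a + y b) / 2\<close> at the edge \<open>ab\<close>, so the part of the relation that involves
  \<open>A\<close> and \<open>\<kappa>\<close> is \<open>2 * \<pi>\<close> times the area-curvature functional of the link (\<open>chi_area_curvature_link\<close>); the
  edge coefficients are unique by \<open>W_combination_unique\<close>. Second, the remaining constants add up to
  \<open>-2 * \<pi>\<close> times the Euler characteristic of the link (\<open>euler_char_link\<close>). This is a count of the cells of
  a triangulated surface; its one topological ingredient is that the boundary of the link is a union of
  circles, that is, that around each boundary edge of the complex there are, with multiplicity, exactly
  two unpaired faces (\<open>card_free_faces_of_boundary_class\<close>).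
\<close>

section \<open>Linear systems and their row dependencies\<close>

lemma dim_kernel_plus_dim_image:
  fixes f :: "'a::euclidean_space \<Rightarrow> 'b::euclidean_space"
  assumes "linear f" and S: "subspace S"
  shows "dim {x \<in> S. f x = 0} + dim (f ` S) = dim S"
proof -
  interpret linear f by fact
  let ?A = "{x \<in> S. f x = 0}"
  let ?B = "{y \<in> S. \<forall>x\<in>?A. orthogonal x y}"
  have A: "subspace ?A"
    using S by (auto simp: subspace_def zero add scale)
  have B: "subspace ?B"
    using S by (auto simp: subspace_def orthogonal_def inner_add_right)
  have "f ` S \<subseteq> f ` ?B"
  proof
    fix y assume "y \<in> f ` S"
    then obtain s where s: "s \<in> S" "y = f s" by blast
    obtain a b where ab: "a \<in> span ?A" "\<And>w. w \<in> span ?A \<Longrightarrow> orthogonal b w" "s = a + b"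
      using orthogonal_subspace_decomp_exists[of ?A s] by blast
    have a: "a \<in> ?A" using ab(1) A by (simp add: span_eq_iff[THEN iffD2])
    have "b \<in> S" using subspace_diff[OF S s(1), of a] a ab(3) by simp
    moreover have "\<forall>x\<in>?A. orthogonal x b"
      using orthogonal_commute[THEN iffD1, OF ab(2)[OF span_base]] by blast
    ultimately have "b \<in> ?B" by blast
    moreover have "y = f b" using s a ab(3) by (simp add: add)
    ultimately show "y \<in> f ` ?B" by blast
  qed
  then have img: "f ` S = f ` ?B" by blast
  have "inj_on f (span ?B)"
  proof (subst span_eq_iff[THEN iffD2, OF B], rule inj_onI)
    fix x y assume xy: "x \<in> ?B" "y \<in> ?B" "f x = f y"
    then have "x - y \<in> ?A" using S by (simp add: diff subspace_diff)
    moreover have "x - y \<in> ?B" by (rule subspace_diff[OF B xy(1,2)])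
    ultimately have "orthogonal (x - y) (x - y)" by blast
    then show "x = y" by (simp add: orthogonal_self)
  qed
  then have "dim (f ` ?B) = dim ?B"
    by (rule dim_image_eq[OF \<open>linear f\<close>])
  then show ?thesis
    unfolding img using dim_subspace_orthogonal_to_vectors[OF A S] by fastforce
qed

text \<open>
The linear relations among the rows indexed by \<open>I\<close>. The index set is a subset of a finite type, and the
coefficients outside it are pinned to \<open>0\<close> so that relations are vectors in a Euclidean space.
\<close>

definition row_dependencies :: "'k set \<Rightarrow> ('k::finite \<Rightarrow> 'a::real_vector) \<Rightarrow> (real ^ 'k) set"
  where "row_dependencies I r =
    {c. (\<forall>k. k \<notin> I \<longrightarrow> c $ k = 0) \<and> (\<Sum>k\<in>I. c $ k *\<^sub>R r k) = 0}"

text \<open>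
The Fredholm alternative. The value map \<open>x \<mapsto> (r k \<bullet> x)\<^sub>k\<close> has as orthogonal complement of its range exactly
the row dependencies. A right-hand side is therefore attained iff all dependencies annihilate it, and
comparing dimensions with the kernel of the value map gives the second formula.
\<close>

lemma
  fixes r :: "'k::finite \<Rightarrow> 'a::euclidean_space" and b :: "'k \<Rightarrow> real"
  shows linear_system_solvable_iff:
      "(\<exists>x. \<forall>k\<in>I. r k \<bullet> x = b k) \<longleftrightarrow> (\<forall>c\<in>row_dependencies I r. (\<Sum>k\<in>I. c $ k * b k) = 0)"
    and dim_homogeneous_solutions:
      "dim {x. \<forall>k\<in>I. r k \<bullet> x = 0} + card I = DIM('a) + dim (row_dependencies I r)"
proof -
  define L :: "'a \<Rightarrow> real ^ 'k" where "L x = (\<chi> k. if k \<in> I then r k \<bullet> x else 0)" for x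
  define T where "T = {y :: real ^ 'k. \<forall>k. k \<notin> I \<longrightarrow> y $ k = 0}"
  let ?D = "row_dependencies I r"
  have L: "linear L"
    by (rule linearI) (auto simp: L_def vec_eq_iff inner_add_right)
  have T: "subspace T" by (auto simp: T_def subspace_def)
  have rL: "subspace (range L)" using L by (simp add: linear_subspace_image)
  have LT: "range L \<subseteq> T" by (auto simp: L_def T_def)
  have dT: "dim T = card I"
    unfolding T_def dim_vec_eq[symmetric] by (rule dim_substandard_cart)
  have dot: "y \<bullet> z = (\<Sum>k\<in>I. z $ k * y $ k)" if "z \<in> T" for y z
  proof -
    have "y \<bullet> z = (\<Sum>k\<in>UNIV. z $ k * y $ k)" by (simp add: inner_vec_def mult.commute)
    also have "\<dots> = (\<Sum>k\<in>I. z $ k * y $ k)"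
      using that by (intro sum.mono_neutral_right) (auto simp: T_def)
    finally show ?thesis .
  qed
  have Ldot: "L x \<bullet> z = (\<Sum>k\<in>I. z $ k *\<^sub>R r k) \<bullet> x" if "z \<in> T" for x z
    by (simp add: dot[OF that] inner_sum_left) (simp add: L_def)
  have D: "?D = {z \<in> T. \<forall>y\<in>range L. orthogonal y z}"
  proof -
    have "(\<Sum>k\<in>I. z $ k *\<^sub>R r k) = 0 \<longleftrightarrow> (\<forall>x. L x \<bullet> z = 0)" if "z \<in> T" for z
    proof
      assume "\<forall>x. L x \<bullet> z = 0"
      then have "(\<Sum>k\<in>I. z $ k *\<^sub>R r k) \<bullet> (\<Sum>k\<in>I. z $ k *\<^sub>R r k) = 0"
        using Ldot[OF that] by simp
      then show "(\<Sum>k\<in>I. z $ k *\<^sub>R r k) = 0" by simp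
    qed (simp add: Ldot[OF that])
    moreover have "z \<in> ?D \<longleftrightarrow> z \<in> T \<and> (\<Sum>k\<in>I. z $ k *\<^sub>R r k) = 0" for z
      by (simp add: row_dependencies_def T_def)
    ultimately show ?thesis unfolding orthogonal_def by blast
  qed
  have ker: "{x. \<forall>k\<in>I. r k \<bullet> x = 0} = {x \<in> UNIV. L x = 0}"
    by (auto simp: L_def vec_eq_iff)
  have "dim ?D + dim (range L) = card I"
    unfolding D using dim_subspace_orthogonal_to_vectors[OF rL T LT] dT by simp
  moreover have "dim {x. \<forall>k\<in>I. r k \<bullet> x = 0} + dim (range L) = DIM('a)"
    unfolding ker using dim_kernel_plus_dim_image[OF L, of UNIV] by simp
  ultimately show "dim {x. \<forall>k\<in>I. r k \<bullet> x = 0} + card I = DIM('a) + dim ?D" by linarith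
  define b' :: "real ^ 'k" where "b' = (\<chi> k. if k \<in> I then b k else 0)"
  have b'T: "b' \<in> T" by (simp add: b'_def T_def)
  have "(\<exists>x. \<forall>k\<in>I. r k \<bullet> x = b k) \<longleftrightarrow> b' \<in> range L"
  proof -
    have "b' = L x \<longleftrightarrow> (\<forall>k\<in>I. r k \<bullet> x = b k)" for x
      by (auto simp: L_def b'_def vec_eq_iff)
    then show ?thesis by (simp add: image_iff)
  qed
  also have "\<dots> \<longleftrightarrow> (\<forall>z\<in>?D. b' \<bullet> z = 0)"
  proof
    assume "b' \<in> range L"
    then show "\<forall>z\<in>?D. b' \<bullet> z = 0" unfolding D by (auto simp: orthogonal_def)
  next
    assume perp: "\<forall>z\<in>?D. b' \<bullet> z = 0"
    obtain y z where yz: "y \<in> span (range L)" "\<And>w. w \<in> span (range L) \<Longrightarrow> orthogonal z w" "b' = y + z"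
      using orthogonal_subspace_decomp_exists[of "range L" b'] by blast
    have y: "y \<in> range L" using yz(1) rL by (simp only: span_eq_iff[THEN iffD2])
    have "z = b' - y" using yz(3) by simp
    then have "z \<in> T" using subspace_diff[OF T b'T, of y] y LT by auto
    then have "z \<in> ?D" unfolding D using orthogonal_commute[THEN iffD1, OF yz(2)[OF span_base]] by blast
    then have "b' \<bullet> z = 0" using perp by blast
    moreover have "y \<bullet> z = 0" using yz(1,2) by (simp add: orthogonal_def inner_commute)
    ultimately have "z \<bullet> z = 0" using yz(3) by (simp add: inner_add_left)
    then show "b' \<in> range L" using y yz(3) by simp
  qed
  also have "\<dots> \<longleftrightarrow> (\<forall>c\<in>?D. (\<Sum>k\<in>I. c $ k * b k) = 0)"
  proof -
    have "b' \<bullet> z = (\<Sum>k\<in>I. z $ k * b k)" if "z \<in> ?D" for z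
      using that by (subst dot) (auto simp: b'_def D)
    then show ?thesis by simp
  qed
  finally show "(\<exists>x. \<forall>k\<in>I. r k \<bullet> x = b k) \<longleftrightarrow> (\<forall>c\<in>?D. (\<Sum>k\<in>I. c $ k * b k) = 0)" .
qed

section \<open>Orbits of two involutions\<close>

text \<open>
Two involutions generate a dihedral group. Starting at a fixed point of \<open>\<tau>\<close>, the rotation \<open>\<tau> \<circ> \<sigma>\<close> alone
sweeps out the whole orbit, so the orbit is a cycle of some length \<open>m\<close> on which \<open>\<tau>\<close> acts as the
reflection \<open>k \<mapsto> -k\<close> and \<open>\<sigma>\<close> as \<open>k \<mapsto> -k-1\<close>. Since \<open>\<sigma>\<close> has no fixed point, \<open>m\<close> is even, and \<open>\<tau>\<close> fixes
exactly \<open>0\<close> and \<open>m/2\<close>.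
\<close>

lemma card_fixed_points_of_dihedral_orbit:
  fixes \<sigma> \<tau> :: "'a::finite \<Rightarrow> 'a"
  assumes \<sigma>: "\<And>x. \<sigma> (\<sigma> x) = x" and \<tau>: "\<And>x. \<tau> (\<tau> x) = x"
    and S\<sigma>: "\<And>x. x \<in> S \<Longrightarrow> \<sigma> x \<in> S \<and> \<sigma> x \<noteq> x" and S\<tau>: "\<And>x. x \<in> S \<Longrightarrow> \<tau> x \<in> S"
    and x0: "x0 \<in> S" "\<tau> x0 = x0"
    and orbit: "\<And>T. x0 \<in> T \<Longrightarrow> \<sigma> ` T \<subseteq> T \<Longrightarrow> \<tau> ` T \<subseteq> T \<Longrightarrow> S \<subseteq> T"
  shows "card {x \<in> S. \<tau> x = x} = 2"
proof -
  define P where "P k = ((\<tau> \<circ> \<sigma>) ^^ k) x0" for k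
  have P0: "P 0 = x0" and PS: "P (Suc k) = \<tau> (\<sigma> (P k))" for k by (simp_all add: P_def)
  have inj: "inj (\<tau> \<circ> \<sigma>)" by (intro inj_compose injI) (metis \<sigma> \<tau>)+
  obtain n where "n > 0" "((\<tau> \<circ> \<sigma>) ^^ n) x0 = x0" by (rule funpow_inj_finite[OF inj finite])
  then have ex: "n > 0 \<and> P n = x0" by (simp add: P_def)
  define m where "m = (LEAST n. n > 0 \<and> P n = x0)"
  have m: "m > 0" "P m = x0" and least: "\<And>k. 0 < k \<Longrightarrow> P k = x0 \<Longrightarrow> m \<le> k"
    using LeastI[of "\<lambda>n. n > 0 \<and> P n = x0", OF ex] Least_le[of "\<lambda>n. n > 0 \<and> P n = x0"]
    unfolding m_def by blast+
  have PinS: "P k \<in> S" for k by (induction k) (simp_all add: P0 PS x0 S\<sigma> S\<tau>)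
  have inj_step: "P j = P k" if "P (Suc j) = P (Suc k)" for j k
    using that injD[OF inj, of "P j" "P k"] by (simp add: PS)
  have inj_aux: "j = 0" if "P (i + j) = P i" "j < m" for i j
    using that
  proof (induction i)
    case 0 then show ?case using least[of j] by (auto simp: P0)
  next
    case (Suc i) then show ?case using inj_step[of "i + j" i] by simp
  qed
  have Pinj: "i = k" if "P i = P k" "i < m" "k < m" for i k
  proof (cases "i \<le> k")
    case True
    then have "k - i = 0" using that by (intro inj_aux[of i "k - i"]) simp_all
    then show ?thesis using True by simp
  next
    case False
    then have "i - k = 0" using that by (intro inj_aux[of k "i - k"]) simp_all
    then show ?thesis using False by simp
  qed
  have \<sigma>P: "\<sigma> (P k) = P (m - Suc k)" if "\<tau> (P k) = P (m - k)" "k < m" for k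
  proof -
    have "\<tau> (\<sigma> (P (m - Suc k))) = \<tau> (P k)"
      using that PS[of "m - Suc k"] by (simp add: Suc_diff_Suc)
    then have "\<sigma> (P (m - Suc k)) = P k" by (metis \<tau>)
    then show ?thesis by (metis \<sigma>)
  qed
  have \<tau>P: "\<tau> (P k) = P (m - k)" if "k \<le> m" for k
    using that
  proof (induction k)
    case 0 then show ?case by (simp add: P0 x0 m)
  next
    case (Suc k) then show ?case using \<sigma>P[of k] by (simp add: PS \<tau>)
  qed
  have S: "S = P ` {..<m}"
  proof
    show "P ` {..<m} \<subseteq> S" using PinS by blast
    show "S \<subseteq> P ` {..<m}"
    proof (rule orbit)
      show "x0 \<in> P ` {..<m}" using m P0 by (metis imageI lessThan_iff)
      have "\<sigma> (P k) \<in> P ` {..<m}" if "k < m" for k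
        using \<sigma>P[of k] \<tau>P[of k] that by simp
      then show "\<sigma> ` P ` {..<m} \<subseteq> P ` {..<m}" by blast
      have "\<tau> (P k) \<in> P ` {..<m}" if "k < m" for k
        using \<tau>P[of k] that m P0 \<open>x0 \<in> P ` {..<m}\<close> by (cases "k = 0") auto
      then show "\<tau> ` P ` {..<m} \<subseteq> P ` {..<m}" by blast
    qed
  qed
  have "even m"
  proof (rule ccontr)
    assume "odd m"
    then obtain k where k: "m = 2 * k + 1" by (rule oddE)
    then have "\<sigma> (P k) = P k" using \<sigma>P[of k] \<tau>P[of k] by simp
    then show False using S\<sigma>[OF PinS] by blast
  qed
  then obtain h where h: "m = 2 * h" by (rule evenE)
  have hm: "0 < h" "h < m" using h m(1) by simp_all
  have fixed_iff: "\<tau> (P k) = P k \<longleftrightarrow> k = 0 \<or> k = h" if "k < m" for k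
  proof (cases "k = 0")
    case True
    then show ?thesis using P0 x0 by simp
  next
    case False
    then have "P (m - k) = P k \<longleftrightarrow> m - k = k" using Pinj[of "m - k" k] that by auto
    then show ?thesis using \<tau>P[of k] that h False by auto
  qed
  have "{x \<in> S. \<tau> x = x} = P ` {k. k < m \<and> \<tau> (P k) = P k}"
    unfolding S by blast
  also have "{k. k < m \<and> \<tau> (P k) = P k} = {0, h}"
    using fixed_iff hm by auto
  finally have "{x \<in> S. \<tau> x = x} = {P 0, P h}" by simp
  moreover have "P 0 \<noteq> P h" using Pinj[of 0 h] hm by auto
  ultimately show ?thesis by simp
qed

section \<open>Edges and quadrilaterals of a tetrahedron\<close>

lemma card_compl_vertices: "card (- V) = 4 - card V" for V :: "4 set"
  using card_Diff_subset[of V UNIV] by (simp add: Compl_eq_Diff_UNIV)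

lemma card_ends: "card (ends e) = 2"
  using ends[of e] by simp

lemma ends_edge_between: "a \<noteq> b \<Longrightarrow> ends (edge_between a b) = {a, b}"
  by (simp add: edge_between_def Abs_tedge_inverse)

lemma card_tedge: "CARD(tedge) = 6"
proof -
  have "ends ` UNIV = {V. V \<subseteq> UNIV \<and> card V = 2}"
    using type_definition.Rep_range[OF type_definition_tedge] by simp
  then have "CARD(tedge) = card {V. V \<subseteq> (UNIV :: 4 set) \<and> card V = 2}"
    using card_image[of ends UNIV] by (simp add: inj_on_def ends_inject)
  also have "\<dots> = 6" by (subst n_subsets) (simp_all add: choose_two)
  finally show ?thesis .
qed

lemma edge_between_if_ends: "ends e = {a, b} \<Longrightarrow> edge_between a b = e"
  by (metis edge_between_def ends_inverse)

lemma edge_cases: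
  obtains a b where "a \<noteq> b" "e = edge_between a b" "ends e = {a, b}"
proof -
  obtain a b where "ends e = {a, b}" "a \<noteq> b"
    using card_ends[of e] by (auto simp: card_2_iff)
  then show thesis using that[of a b] edge_between_if_ends[of e a b] by simp
qed

lemma edge_between_commute: "edge_between a b = edge_between b a"
  by (simp add: edge_between_def insert_commute)

lemma edge_between_eq_iff:
  assumes "a \<noteq> b" "c \<noteq> d"
  shows "edge_between a b = edge_between c d \<longleftrightarrow> a = c \<and> b = d \<or> a = d \<and> b = c"
proof -
  have "edge_between a b = edge_between c d \<longleftrightarrow> {a, b} = {c, d}"
    using assms by (metis ends_edge_between ends_inject)
  then show ?thesis by (simp add: doubleton_eq_iff)
qed

lemma map_edge_edge_between:
  assumes "a \<noteq> b"
  shows "map_edge g (edge_between a b) = edge_between (g a) (g b)"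
  using assms by (simp add: map_edge_def ends_edge_between edge_between_def[of "g a"])

lemma sum_edges_at_corner:
  fixes z :: "tedge \<Rightarrow> 'a::comm_monoid_add"
  shows "(\<Sum>e | v \<in> ends e. z e) = (\<Sum>b\<in>- {v}. z (edge_between v b))"
proof (rule sum.reindex_bij_betw[symmetric])
  show "bij_betw (edge_between v) (- {v}) {e. v \<in> ends e}"
  proof (rule bij_betwI')
    show "edge_between v a = edge_between v b \<longleftrightarrow> a = b" if "a \<in> - {v}" "b \<in> - {v}" for a b
      using that by (auto simp: edge_between_eq_iff)
    show "edge_between v b \<in> {e. v \<in> ends e}" if "b \<in> - {v}" for b
      using that by (simp add: ends_edge_between)
    show "\<exists>b\<in>- {v}. e = edge_between v b" if "e \<in> {e. v \<in> ends e}" for e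
      using that by (cases e rule: edge_cases) (auto simp: edge_between_commute)
  qed
qed

lemma sum_edge_ends:
  fixes F :: "tedge \<Rightarrow> 4 \<Rightarrow> 'a::comm_monoid_add"
  shows "(\<Sum>e\<in>UNIV. \<Sum>v\<in>ends e. F e v) = (\<Sum>v\<in>UNIV. \<Sum>b\<in>- {v}. F (edge_between v b) v)"
proof -
  have "(\<Sum>e\<in>UNIV. \<Sum>v\<in>ends e. F e v) = (\<Sum>v\<in>UNIV. \<Sum>e | v \<in> ends e. F e v)"
    using sum.swap_restrict[of UNIV UNIV F "\<lambda>e v. v \<in> ends e"] by simp
  then show ?thesis by (simp add: sum_edges_at_corner)
qed

definition opposite :: "tedge \<Rightarrow> tedge"
  where "opposite e = Abs_tedge (- ends e)"

lemma ends_opposite: "ends (opposite e) = - ends e"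
  by (simp add: opposite_def Abs_tedge_inverse card_compl_vertices card_ends)

lemma quad_cases:
  obtains e where "q = quad_facing e"
proof -
  obtain s :: "4 set" where s: "sides q = {s, - s}" "card s = 2"
    using sides[of q] by blast
  have "quad_facing (Abs_tedge s) = q"
    using s by (simp add: quad_facing_def Abs_tedge_inverse flip: s(1) add: sides_inverse)
  then show thesis using that by metis
qed

lemma edges_facing_quad: "{e'. quad_facing e' = quad_facing e} = {e, opposite e}"
proof -
  have sides: "sides (quad_facing e) = {ends e, - ends e}" for e
    unfolding quad_facing_def using card_ends by (intro Abs_tquad_inverse) blast
  have "quad_facing e' = quad_facing e \<longleftrightarrow> ends e' = ends e \<or> ends e' = - ends e" for e'
    by (subst sides_inject[symmetric]) (auto simp: sides doubleton_eq_iff)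
  then show ?thesis by (auto simp: ends_inject simp flip: ends_opposite)
qed

lemma opposite_neq: "opposite e \<noteq> e"
  using ends_opposite[of e] by (metis Compl_disjoint card.empty card_ends inf.idem zero_neq_numeral)

lemma sum_edges_facing_quad:
  fixes z :: "tedge \<Rightarrow> 'a::comm_monoid_add"
  shows "(\<Sum>e' | quad_facing e' = quad_facing e. z e') = z e + z (opposite e)"
  using opposite_neq[of e] by (simp add: edges_facing_quad)

text \<open>
For an edge \<open>ab\<close> with opposite edge \<open>cd\<close>, the two corner equations at \<open>a\<close> and \<open>b\<close> minus the quadrilateral
equations of \<open>ac\<close> and \<open>ad\<close> leave \<open>2 * z(ab) = 0\<close>. This is the local part of the
linear independence of the vectors \<open>W_tet i\<close> and \<open>W_edge E\<close>.
\<close>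

lemma edge_function_zero_if_constant_sums:
  fixes z :: "tedge \<Rightarrow> real"
  assumes corner: "\<And>v. w + (\<Sum>e | v \<in> ends e. z e) = 0"
    and quad: "\<And>e. w + (z e + z (opposite e)) = 0"
  shows "z e = 0"
proof (cases e rule: edge_cases)
  case (1 a b)
  have "card (- {a, b}) = 2" using 1(1) by (simp add: card_compl_vertices)
  then obtain c d where cd: "- {a, b} = {c, d}" "c \<noteq> d" by (auto simp: card_2_iff)
  have ne: "a \<noteq> c" "a \<noteq> d" "b \<noteq> c" "b \<noteq> d" using cd by blast+
  have U: "UNIV = {a, b, c, d}" using cd(1) by blast
  have compl: "- {a} = {b, c, d}" "- {b} = {a, c, d}" "- {a, c} = {b, d}" "- {a, d} = {b, c}"
    unfolding Compl_eq_Diff_UNIV U using ne cd(2) 1(1) by auto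
  have opp: "opposite (edge_between x y) = edge_between x' y'"
    if "- {x, y} = {x', y'}" "x \<noteq> y" for x y x' y'
    using that by (intro edge_between_if_ends[symmetric]) (simp add: ends_opposite ends_edge_between)
  have "w + (z (edge_between a b) + z (edge_between a c) + z (edge_between a d)) = 0"
    using corner[of a] ne cd(2) 1(1) by (simp add: sum_edges_at_corner compl)
  moreover have "w + (z (edge_between a b) + z (edge_between b c) + z (edge_between b d)) = 0"
    using corner[of b] ne cd(2) 1(1) by (simp add: sum_edges_at_corner compl edge_between_commute[of b a])
  moreover have "w + (z (edge_between a c) + z (edge_between b d)) = 0"
    using quad[of "edge_between a c"] opp[OF compl(3)] ne by simp
  moreover have "w + (z (edge_between a d) + z (edge_between b c)) = 0"
    using quad[of "edge_between a d"] opp[OF compl(4)] ne by simp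
  ultimately show ?thesis using 1(2) by simp
qed

text \<open>
This operation turns functions on corners into functions on edges. It appears twice: up to sign it
determines the edge coefficients of a dependency among the angle equations, and half of it gives the
coefficients of the \<open>W_edge E\<close> in the expansion of a vertex link.
\<close>

definition ends_sum :: "('t \<times> 4 \<Rightarrow> real) \<Rightarrow> 't \<times> tedge \<Rightarrow> real"
  where "ends_sum y = (\<lambda>(i, e). \<Sum>v\<in>ends e. y (i, v))"

lemma ends_sum_edge_between: "a \<noteq> b \<Longrightarrow> ends_sum y (i, edge_between a b) = y (i, a) + y (i, b)"
  by (simp add: ends_sum_def ends_edge_between)

lemma ends_sum_opposite: "ends_sum y (i, e) + ends_sum y (i, opposite e) = (\<Sum>v\<in>UNIV. y (i, v))"
  using sum.union_disjoint[of "ends e" "- ends e" "\<lambda>v. y (i, v)"]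
  by (simp add: ends_sum_def ends_opposite)

lemma sum_ends_sum_at_corner:
  "(\<Sum>e | v \<in> ends e. ends_sum y (i, e)) = 2 * y (i, v) + (\<Sum>v'\<in>UNIV. y (i, v'))"
proof -
  have "(\<Sum>e | v \<in> ends e. ends_sum y (i, e)) = (\<Sum>b\<in>- {v}. y (i, v) + y (i, b))"
    unfolding sum_edges_at_corner by (intro sum.cong) (auto simp: ends_sum_edge_between)
  also have "\<dots> = 3 * y (i, v) + (\<Sum>b\<in>- {v}. y (i, b))"
    by (simp add: sum.distrib card_compl_vertices)
  also have "\<dots> = 2 * y (i, v) + (\<Sum>v'\<in>UNIV. y (i, v'))"
    by (simp add: Compl_eq_Diff_UNIV sum_diff)
  finally show ?thesis .
qed

section \<open>Sums over equivalence classes\<close>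

lemma equiv_equiv_closure: "equiv UNIV (equiv_closure r)"
proof (rule equivI)
  show "sym (equiv_closure r)" unfolding equiv_closure_def by (intro sym_rtrancl sym_Un_converse)
  show "trans (equiv_closure r)" unfolding equiv_closure_def by (rule trans_rtrancl)
  show "refl (equiv_closure r)" unfolding equiv_closure_def by (rule refl_rtrancl)
qed simp

lemma equiv_closure_invariant:
  assumes "(x, y) \<in> equiv_closure r" and "\<And>x y. (x, y) \<in> r \<Longrightarrow> h x = h y"
  shows "h x = h y"
  using assms(1) unfolding equiv_closure_def
  by (induction rule: rtrancl_induct) (auto simp: assms(2))

lemma equiv_closure_closed:
  assumes "(x, y) \<in> equiv_closure r" and "P x"
    and "\<And>u v. (u, v) \<in> r \<Longrightarrow> P u \<Longrightarrow> P v" and "\<And>u v. (u, v) \<in> r \<Longrightarrow> P v \<Longrightarrow> P u"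
  shows "P y"
  using assms(1) unfolding equiv_closure_def
  by (induction rule: rtrancl_induct) (use assms(2-4) in blast)+

lemma equiv_closure_base: "(x, y) \<in> r \<Longrightarrow> (x, y) \<in> equiv_closure r"
  by (auto simp: equiv_closure_def)

lemma sum_over_classes:
  assumes "equiv A r" and "finite D" "D \<subseteq> A" and closed: "r `` D \<subseteq> D"
  shows "(\<Sum>C\<in>D // r. \<Sum>d\<in>C. F C d) = (\<Sum>d\<in>D. F (r `` {d}) d)"
proof -
  have "(\<Sum>d\<in>D. F (r `` {d}) d)
      = (\<Sum>C\<in>(\<lambda>d. r `` {d}) ` D. \<Sum>d\<in>{d \<in> D. r `` {d} = C}. F (r `` {d}) d)"
    using \<open>finite D\<close> by (rule sum.image_gen)
  also have "(\<lambda>d. r `` {d}) ` D = D // r" by (auto simp: quotient_def)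
  also have "(\<Sum>C\<in>D // r. \<Sum>d\<in>{d \<in> D. r `` {d} = C}. F (r `` {d}) d) = (\<Sum>C\<in>D // r. \<Sum>d\<in>C. F C d)"
  proof (rule sum.cong)
    fix C assume "C \<in> D // r"
    then obtain c where c: "c \<in> D" "C = r `` {c}" by (rule quotientE)
    have "d \<in> C \<longleftrightarrow> d \<in> D \<and> r `` {d} = C" for d
      using c assms equiv_class_eq_iff[OF assms(1), of c d] by auto
    then have "{d \<in> D. r `` {d} = C} = C" by blast
    moreover have "F (r `` {d}) d = F C d" if "d \<in> {d \<in> D. r `` {d} = C}" for d
      using that by simp
    ultimately show "(\<Sum>d\<in>{d \<in> D. r `` {d} = C}. F (r `` {d}) d) = (\<Sum>d\<in>C. F C d)"
      by (intro sum.cong) simp_all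
  qed simp
  finally show ?thesis by simp
qed

text \<open>
Giving each element the weight \<open>1\<close> over the size of its class turns a sum over classes into a sum over
elements. Sums over different kinds of cells of the glued complex become comparable in this way,
because before gluing the incidences are those of single tetrahedra.
\<close>

lemma sum_over_classes_averaged:
  fixes F :: "'a set \<Rightarrow> real"
  assumes "equiv A r" and "finite D" "D \<subseteq> A" and "r `` D \<subseteq> D"
  shows "(\<Sum>C\<in>D // r. F C) = (\<Sum>d\<in>D. F (r `` {d}) / card (r `` {d}))"
proof -
  have "(\<Sum>d\<in>C. F C / card C) = F C" if "C \<in> D // r" for C
  proof -
    obtain c where c: "c \<in> D" "C = r `` {c}" using \<open>C \<in> D // r\<close> by (rule quotientE)
    have "finite C" using c assms finite_subset[of C D] by auto
    moreover have "c \<in> C" using c assms equiv_class_self by fastforce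
    ultimately have "card C \<noteq> 0" by auto
    then show ?thesis by simp
  qed
  then have "(\<Sum>C\<in>D // r. F C) = (\<Sum>C\<in>D // r. \<Sum>d\<in>C. F C / card C)" by simp
  also have "\<dots> = (\<Sum>d\<in>D. F (r `` {d}) / card (r `` {d}))" using assms by (rule sum_over_classes)
  finally show ?thesis .
qed

text \<open>
The value of a function that is constant on the class; this is the induced function on the quotient.
\<close>

definition class_value :: "('a \<Rightarrow> 'b) \<Rightarrow> 'a set \<Rightarrow> 'b"
  where "class_value h C = the_elem (h ` C)"

lemma class_value_class:
  assumes "equiv A r" and "\<And>x y. (x, y) \<in> r \<Longrightarrow> h x = h y" and "x \<in> A"
  shows "class_value h (r `` {x}) = h x"
proof -
  have "h y = h x" if "y \<in> r `` {x}" for y using assms(2)[of x y] that by simp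
  then have "h ` (r `` {x}) = {h x}" using equiv_class_self[OF assms(1,3)] by blast
  then show ?thesis by (simp add: class_value_def)
qed

section \<open>Face pairings and the classes of corners, edges and arcs\<close>

text \<open>
The pairings together with their inverses, so that every paired face is the source of exactly one
pairing.
\<close>

definition both_ways :: "'t pairing set \<Rightarrow> 't pairing set"
  where "both_ways \<Phi> = \<Phi> \<union> {(j, g f, i, inv g) | i f j g. (i, f, j, g) \<in> \<Phi>}"

locale pseudomanifold =
  fixes \<Phi> :: "('t::finite) pairing set"
  assumes triangulated: "triangulated_pseudomanifold \<Phi>"
begin

lemma pairing:
  assumes "(i, f, j, g) \<in> \<Phi>"
  shows "bij g" "(i, f) \<noteq> (j, g f)"
  using assms triangulated unfolding triangulated_pseudomanifold_def by fast+

lemma face_in_one_pairing: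
  assumes "\<phi> \<in> \<Phi>" "\<psi> \<in> \<Phi>" "F \<in> paired_faces \<phi>" "F \<in> paired_faces \<psi>"
  shows "\<phi> = \<psi>"
  using assms triangulated unfolding triangulated_pseudomanifold_def pairwise_def by blast

lemma both_ways_cases:
  assumes "(i, f, j, g) \<in> both_ways \<Phi>"
  obtains "(i, f, j, g) \<in> \<Phi>" | "(j, g f, i, inv g) \<in> \<Phi>" "bij g"
proof (cases "(i, f, j, g) \<in> \<Phi>")
  case False
  then obtain f' g' where *: "f = g' f'" "g = inv g'" "(j, f', i, g') \<in> \<Phi>"
    using assms by (auto simp: both_ways_def)
  have bij: "bij g'" using pairing(1)[OF *(3)] .
  have "g f = f'" "inv g = g'" using * bij by (simp_all add: bij_is_inj inv_inv_eq)
  then show thesis using that(2) * bij_imp_bij_inv[OF bij] by simp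
qed

lemma both_ways_bij: "(i, f, j, g) \<in> both_ways \<Phi> \<Longrightarrow> bij g"
  by (elim both_ways_cases) (use pairing(1) in blast)+

lemma both_ways_reverse:
  assumes "(i, f, j, g) \<in> both_ways \<Phi>"
  shows "(j, g f, i, inv g) \<in> both_ways \<Phi>"
  using assms by (elim both_ways_cases) (unfold both_ways_def, blast+)

lemma both_ways_neq:
  assumes "(i, f, j, g) \<in> both_ways \<Phi>"
  shows "(i, f) \<noteq> (j, g f)"
  using assms
proof (cases rule: both_ways_cases)
  case 2
  then show ?thesis using pairing(2)[OF 2(1)] by (auto simp: bij_is_inj)
qed (use pairing(2) in blast)

lemma both_ways_unique:
  assumes "(i, f, j, g) \<in> both_ways \<Phi>" "(i, f, j', g') \<in> both_ways \<Phi>"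
  shows "j' = j" "g' = g"
proof -
  have "j' = j \<and> g' = g"
    using assms(1)
  proof (cases rule: both_ways_cases)
    case 1
    from assms(2) show ?thesis
    proof (cases rule: both_ways_cases)
      case fwd: 1
      then show ?thesis using face_in_one_pairing[OF 1 fwd, of "(i, f)"] by simp
    next
      case bwd: 2
      have "(i, f, j, g) = (j', g' f, i, inv g')"
        using face_in_one_pairing[OF 1 bwd(1), of "(i, f)"] bwd(2) by (simp add: bij_is_inj)
      then have "i = j" "g f = f" using bwd(2) by (auto simp: bij_is_inj inv_f_eq)
      then show ?thesis using pairing(2)[OF 1] by simp
    qed
  next
    case 2
    from assms(2) show ?thesis
    proof (cases rule: both_ways_cases)
      case fwd: 1
      have "(i, f, j', g') = (j, g f, i, inv g)"
        using face_in_one_pairing[OF fwd 2(1), of "(i, f)"] 2(2) by (simp add: bij_is_inj)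
      then have "i = j'" "g' f = f" using 2(2) by (auto simp: bij_is_inj inv_f_eq)
      then show ?thesis using pairing(2)[OF fwd] by simp
    next
      case bwd: 2
      have "(j, g f, i, inv g) = (j', g' f, i, inv g')"
        using 2(2) bwd(2)
        by (intro face_in_one_pairing[OF 2(1) bwd(1), of "(i, f)"]) (simp_all add: bij_is_inj)
      then show ?thesis using 2(2) bwd(2) by (metis inv_inv_eq prod.inject)
    qed
  qed
  then show "j' = j" "g' = g" by simp_all
qed

lemma unpaired_face_iff: "unpaired_face \<Phi> (i, f) \<longleftrightarrow> (\<nexists>j g. (i, f, j, g) \<in> both_ways \<Phi>)"
proof -
  have "(\<exists>j g. (i, f, j, g) \<in> both_ways \<Phi>) \<longleftrightarrow> (\<exists>\<phi>\<in>\<Phi>. (i, f) \<in> paired_faces \<phi>)"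
  proof
    assume "\<exists>j g. (i, f, j, g) \<in> both_ways \<Phi>"
    then obtain j g where "(i, f, j, g) \<in> both_ways \<Phi>" by blast
    then show "\<exists>\<phi>\<in>\<Phi>. (i, f) \<in> paired_faces \<phi>"
    proof (cases rule: both_ways_cases)
      case 2
      then show ?thesis by (intro bexI[OF _ 2(1)]) (simp add: bij_is_inj)
    qed force
  next
    assume "\<exists>\<phi>\<in>\<Phi>. (i, f) \<in> paired_faces \<phi>"
    then obtain i' f' j g where *: "(i', f', j, g) \<in> \<Phi>" "(i, f) \<in> {(i', f'), (j, g f')}"
      by (metis paired_faces.elims)
    then have "(i', f', j, g) \<in> both_ways \<Phi>" by (simp add: both_ways_def)
    then show "\<exists>j g. (i, f, j, g) \<in> both_ways \<Phi>"
      using both_ways_reverse *(2) by blast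
  qed
  then show ?thesis by (simp add: unpaired_face_def)
qed

lemma ends_sum_constant:
  assumes y: "\<And>p q. (p, q) \<in> corner_equiv \<Phi> \<Longrightarrow> y p = y q" and "(x, x') \<in> edge_equiv \<Phi>"
  shows "ends_sum y x = ends_sum y x'"
  using assms(2) unfolding edge_equiv_def
proof (rule equiv_closure_invariant, clarify)
  fix i f j g e assume \<phi>: "(i, f, j, g) \<in> \<Phi>" and "f \<notin> ends e"
  obtain a b where e: "a \<noteq> b" "e = edge_between a b" "ends e = {a, b}" by (rule edge_cases)
  have "y (i, v) = y (j, g v)" if "v \<noteq> f" for v
    using \<phi> that 
    by (intro y, unfold corner_equiv_def, intro equiv_closure_base) blast
  then have "y (i, a) = y (j, g a)" "y (i, b) = y (j, g b)"
    using e(3) \<open>f \<notin> ends e\<close> by auto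
  moreover have "g a \<noteq> g b" using pairing(1)[OF \<phi>] e(1) by (metis bij_is_inj injD)
  ultimately show "ends_sum y (i, e) = ends_sum y (j, map_edge g e)"
    using e(1,2) by (simp add: map_edge_edge_between ends_sum_edge_between)
qed

text \<open>
In a triangle, the three pairwise sums of the values at the vertices determine the values: twice the
value at \<open>v\<close> is the sum over the two sides at \<open>v\<close> minus the third side. Hence if a gluing preserves the
sums on the edges of a face, it preserves the values at its vertices.
\<close>

lemma constant_if_ends_sum_constant:
  assumes y: "\<And>x x'. (x, x') \<in> edge_equiv \<Phi> \<Longrightarrow> ends_sum y x = ends_sum y x'"
    and "(p, q) \<in> corner_equiv \<Phi>"
  shows "y p = y q"
  using assms(2) unfolding corner_equiv_def
proof (rule equiv_closure_invariant, clarify)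
  fix i f j g v assume \<phi>: "(i, f, j, g) \<in> \<Phi>" and "v \<noteq> f"
  then have "card (- {f, v}) = 2" by (simp add: card_compl_vertices)
  then obtain b c where bc: "- {f, v} = {b, c}" "b \<noteq> c" by (auto simp: card_2_iff)
  then have ne: "b \<noteq> v" "c \<noteq> v" "b \<noteq> f" "c \<noteq> f" by blast+
  have g: "g x = g x' \<longleftrightarrow> x = x'" for x x' using pairing(1)[OF \<phi>] by (metis bij_is_inj injD)
  have "y (i, x) + y (i, x') = y (j, g x) + y (j, g x')" if "x \<noteq> f" "x' \<noteq> f" "x \<noteq> x'" for x x'
  proof -
    have "f \<notin> ends (edge_between x x')" using that by (simp add: ends_edge_between)
    then have "((i, edge_between x x'), (j, map_edge g (edge_between x x'))) \<in> edge_equiv \<Phi>"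
      using \<phi> unfolding edge_equiv_def by (intro equiv_closure_base) blast
    from y[OF this] show ?thesis
      using that by (simp add: map_edge_edge_between ends_sum_edge_between g)
  qed
  from this[of v b] this[of v c] this[of b c] show "y (i, v) = y (j, g v)"
    using ne bc(2) \<open>v \<noteq> f\<close> by simp
qed

lemma equiv_oriented_edge: "equiv UNIV (oriented_edge_equiv \<Phi>)"
  and equiv_edge: "equiv UNIV (edge_equiv \<Phi>)"
  and equiv_corner: "equiv UNIV (corner_equiv \<Phi>)"
  and equiv_arc: "equiv UNIV (arc_equiv \<Phi>)"
  by (simp_all add: oriented_edge_equiv_def edge_equiv_def corner_equiv_def arc_equiv_def
      equiv_equiv_closure)

lemma oriented_edge_sym:
  "(x, y) \<in> oriented_edge_equiv \<Phi> \<Longrightarrow> (y, x) \<in> oriented_edge_equiv \<Phi>"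
  using equiv_oriented_edge unfolding equiv_def by (blast dest: symD)

lemma oriented_edge_trans:
  "(x, y) \<in> oriented_edge_equiv \<Phi> \<Longrightarrow> (y, z) \<in> oriented_edge_equiv \<Phi> \<Longrightarrow>
    (x, z) \<in> oriented_edge_equiv \<Phi>"
  using equiv_oriented_edge unfolding equiv_def by (blast dest: transD)

lemma oriented_edge_step:
  assumes "(i, f, j, g) \<in> both_ways \<Phi>" "a \<noteq> f" "b \<noteq> f" "a \<noteq> b"
  shows "((i, a, b), (j, g a, g b)) \<in> oriented_edge_equiv \<Phi>"
  using assms(1)
proof (cases rule: both_ways_cases)
  case 1
  then show ?thesis
    unfolding oriented_edge_equiv_def using assms by (intro equiv_closure_base) blast
next
  case 2
  have g: "g x = g x' \<longleftrightarrow> x = x'" "inv g (g x) = x" for x x'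
    using 2(2) by (auto simp: bij_is_inj inj_eq)
  have "((j, g a, g b), (i, inv g (g a), inv g (g b))) \<in> oriented_edge_equiv \<Phi>"
    unfolding oriented_edge_equiv_def using assms(2-4) 2(1) g(1)
    by (intro equiv_closure_base) blast
  then show ?thesis
    unfolding g by (rule oriented_edge_sym)
qed

lemma oriented_edge_closed:
  assumes "(x, y) \<in> oriented_edge_equiv \<Phi>" "P x"
    and step: "\<And>i f j g a b. (i, f, j, g) \<in> both_ways \<Phi> \<Longrightarrow> a \<noteq> f \<Longrightarrow> b \<noteq> f \<Longrightarrow> a \<noteq> b \<Longrightarrow>
      P (i, a, b) \<Longrightarrow> P (j, g a, g b)"
  shows "P y"
  using assms(1,2) unfolding oriented_edge_equiv_def
proof (rule equiv_closure_closed, goal_cases)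
  case (1 u v)
  then obtain i f j g a b where *: "(i, f, j, g) \<in> \<Phi>" "a \<noteq> f" "b \<noteq> f" "a \<noteq> b"
    "u = (i, a, b)" "v = (j, g a, g b)" by blast
  have "(i, f, j, g) \<in> both_ways \<Phi>" using *(1) by (simp add: both_ways_def)
  from step[OF this, of a b] show ?case using * 1(2) by simp
next
  case (2 u v)
  then obtain i f j g a b where *: "(i, f, j, g) \<in> \<Phi>" "a \<noteq> f" "b \<noteq> f" "a \<noteq> b"
    "u = (i, a, b)" "v = (j, g a, g b)" by blast
  have g: "g x = g x' \<longleftrightarrow> x = x'" "inv g (g x) = x" for x x'
    using pairing(1)[OF *(1)] by (auto simp: bij_is_inj inj_eq)
  have "(j, g f, i, inv g) \<in> both_ways \<Phi>" using *(1) by (auto simp: both_ways_def)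
  from step[OF this, of "g a" "g b"] show ?case using * 2(2) by (simp add: g)
qed

lemma oriented_edge_neq:
  assumes "((i, a, b), (j, c, d)) \<in> oriented_edge_equiv \<Phi>" "a \<noteq> b"
  shows "c \<noteq> d"
  using oriented_edge_closed[OF assms(1), of "\<lambda>(j, c, d). c \<noteq> d"] assms(2) both_ways_bij
  by (auto simp: bij_is_inj inj_eq)

lemma oriented_imp_edge_equiv:
  assumes "((i, a, b), (j, c, d)) \<in> oriented_edge_equiv \<Phi>" "a \<noteq> b"
  shows "((i, edge_between a b), (j, edge_between c d)) \<in> edge_equiv \<Phi>"
proof -
  define h where "h = (\<lambda>(j, c, d). (c \<noteq> d, edge_equiv \<Phi> `` {(j, edge_between c d)}))"
  have "h (i, a, b) = h (j, c, d)"
    using assms(1) unfolding oriented_edge_equiv_def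
  proof (rule equiv_closure_invariant, clarify)
    fix i f j g a b assume *: "(i, f, j, g) \<in> \<Phi>" "a \<noteq> f" "b \<noteq> f" "a \<noteq> (b :: 4)"
    have "((i, edge_between a b), (j, map_edge g (edge_between a b))) \<in> edge_equiv \<Phi>"
      unfolding edge_equiv_def using * by (intro equiv_closure_base) (auto simp: ends_edge_between)
    then have "edge_equiv \<Phi> `` {(i, edge_between a b)} = edge_equiv \<Phi> `` {(j, edge_between (g a) (g b))}"
      using *(4) by (intro equiv_class_eq[OF equiv_edge]) (simp add: map_edge_edge_between)
    moreover have "g a \<noteq> g b" using pairing(1)[OF *(1)] *(4) by (metis bij_is_inj injD)
    ultimately show "h (i, a, b) = h (j, g a, g b)" using *(4) by (simp add: h_def)
  qed
  then show ?thesis using eq_equiv_class[OF _ equiv_edge] by (simp add: h_def)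
qed

lemma edge_equiv_imp_oriented:
  assumes "(x, y) \<in> edge_equiv \<Phi>" and "x = (i, edge_between a b)" "a \<noteq> b"
  shows "\<exists>c d. c \<noteq> d \<and> snd y = edge_between c d \<and> ((i, a, b), (fst y, c, d)) \<in> oriented_edge_equiv \<Phi>"
  using assms(1) unfolding edge_equiv_def
proof (rule equiv_closure_closed, goal_cases)
  case 1
  have "((i, a, b), (i, a, b)) \<in> oriented_edge_equiv \<Phi>"
    using equiv_class_self[OF equiv_oriented_edge] by blast
  then show ?case using assms(2,3) by auto
next
  case (2 u v)
  then obtain k f j g e c d where *: "(k, f, j, g) \<in> \<Phi>" "f \<notin> ends e" "u = (k, e)"
    "v = (j, map_edge g e)" "c \<noteq> d" "e = edge_between c d"
    "((i, a, b), (k, c, d)) \<in> oriented_edge_equiv \<Phi>" by auto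
  have "(k, f, j, g) \<in> both_ways \<Phi>" using *(1) by (simp add: both_ways_def)
  from oriented_edge_step[OF this, of c d]
  have "((k, c, d), (j, g c, g d)) \<in> oriented_edge_equiv \<Phi>"
    using * by (auto simp: ends_edge_between)
  moreover from this have "g c \<noteq> g d" using oriented_edge_neq *(5) by blast
  moreover have "((i, a, b), (j, g c, g d)) \<in> oriented_edge_equiv \<Phi>"
    using *(7) calculation(1) by (rule oriented_edge_trans)
  ultimately show ?case using * by (auto simp: map_edge_edge_between)
next
  case (3 u v)
  then obtain k f j g e c' d' where *: "(k, f, j, g) \<in> \<Phi>" "f \<notin> ends e" "u = (k, e)"
    "v = (j, map_edge g e)" "c' \<noteq> d'" "map_edge g e = edge_between c' d'"
    "((i, a, b), (j, c', d')) \<in> oriented_edge_equiv \<Phi>" by auto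
  obtain c d where e: "c \<noteq> d" "e = edge_between c d" "ends e = {c, d}" by (rule edge_cases)
  have "(k, f, j, g) \<in> both_ways \<Phi>" using *(1) by (simp add: both_ways_def)
  note step = oriented_edge_step[OF this]
  have cd: "((j, g c, g d), (k, c, d)) \<in> oriented_edge_equiv \<Phi>"
    "((j, g d, g c), (k, d, c)) \<in> oriented_edge_equiv \<Phi>"
    using e *(2) by (auto intro!: oriented_edge_sym[OF step])
  have "g c \<noteq> g d" using pairing(1)[OF *(1)] e(1) by (metis bij_is_inj injD)
  then have "c' = g c \<and> d' = g d \<or> c' = g d \<and> d' = g c"
    using *(5,6) e by (simp add: map_edge_edge_between edge_between_eq_iff) metis
  then have "((i, a, b), (k, c, d)) \<in> oriented_edge_equiv \<Phi> \<or>
      ((i, a, b), (k, d, c)) \<in> oriented_edge_equiv \<Phi>"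
    using *(7) cd oriented_edge_trans by blast
  moreover have "snd u = edge_between c d" "snd u = edge_between d c" "fst u = k"
    using * e(2) by (simp_all add: edge_between_commute[of d c])
  ultimately show ?case using e(1) by metis
qed

text \<open>
An orientation of one edge spreads to the whole edge class. It does so consistently, because no edge is
identified with its own reverse; so each edge class corresponds to two oriented edge classes of the
same size.
\<close>

lemma edge_class_bij:
  assumes "a \<noteq> b"
  shows "bij_betw (\<lambda>(j, c, d). (j, edge_between c d))
    (oriented_edge_equiv \<Phi> `` {(i, a, b)}) (edge_equiv \<Phi> `` {(i, edge_between a b)})"
  unfolding bij_betw_def
proof
  let ?h = "\<lambda>(j, c, d). (j, edge_between c d)"
  let ?C = "oriented_edge_equiv \<Phi> `` {(i, a, b)}"
  let ?E = "edge_equiv \<Phi> `` {(i, edge_between a b)}"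
  show "inj_on ?h ?C"
  proof (rule inj_onI)
    fix x x' assume "x \<in> ?C" "x' \<in> ?C" "?h x = ?h x'"
    then obtain j c d c' d' where x: "x = (j, c, d)" "x' = (j, c', d')"
      and 1: "((i, a, b), (j, c, d)) \<in> oriented_edge_equiv \<Phi>"
      and 2: "((i, a, b), (j, c', d')) \<in> oriented_edge_equiv \<Phi>"
      and eq: "edge_between c d = edge_between c' d'"
      by (cases x, cases x') auto
    have "((j, c, d), (j, c', d')) \<in> oriented_edge_equiv \<Phi>"
      using oriented_edge_trans[OF oriented_edge_sym[OF 1] 2] .
    moreover have ne: "c \<noteq> d" "c' \<noteq> d'" using 1 2 oriented_edge_neq assms by blast+
    ultimately have "\<not> (c = d' \<and> d = c')"
      using triangulated unfolding triangulated_pseudomanifold_def by blast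
    then show "x = x'" using x eq edge_between_eq_iff[OF ne] by blast
  qed
  show "?h ` ?C = ?E"
  proof
    show "?h ` ?C \<subseteq> ?E" using oriented_imp_edge_equiv assms by auto
    show "?E \<subseteq> ?h ` ?C"
    proof
      fix y assume "y \<in> ?E"
      then have "((i, edge_between a b), y) \<in> edge_equiv \<Phi>" by simp
      from edge_equiv_imp_oriented[OF this refl assms] obtain c d
        where "snd y = edge_between c d" "((i, a, b), (fst y, c, d)) \<in> oriented_edge_equiv \<Phi>"
        by blast
      then show "y \<in> ?h ` ?C" by (intro image_eqI[of _ _ "(fst y, c, d)"]) (auto simp: prod_eq_iff)
    qed
  qed
qed

text \<open>
An arc lies in a single face, so it is glued to at most one other arc.
\<close>

lemma card_arc_class:
  assumes "v \<noteq> f"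
  shows "card (arc_equiv \<Phi> `` {(i, f, v)}) = (if unpaired_face \<Phi> (i, f) then 1 else 2)"
proof -
  \<comment> \<open>a set of arcs closed under all gluings contains the classes of its members\<close>
  have closed: "y \<in> T" if "((i, f, v), y) \<in> arc_equiv \<Phi>" "(i, f, v) \<in> T"
    and T: "\<And>i f j g v. (i, f, j, g) \<in> both_ways \<Phi> \<Longrightarrow> (i, f, v) \<in> T \<Longrightarrow> (j, g f, g v) \<in> T" for T y
    using that(1,2) unfolding arc_equiv_def
  proof (rule equiv_closure_closed, goal_cases)
    case (1 u w)
    then obtain i f j g v where *: "(i, f, j, g) \<in> \<Phi>" "u = (i, f, v)" "w = (j, g f, g v)" by blast
    have "(i, f, j, g) \<in> both_ways \<Phi>" using *(1) by (simp add: both_ways_def)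
    from T[OF this] show ?case using * 1(2) by simp
  next
    case (2 u w)
    then obtain i f j g v where *: "(i, f, j, g) \<in> \<Phi>" "u = (i, f, v)" "w = (j, g f, g v)" by blast
    have "(j, g f, i, inv g) \<in> both_ways \<Phi>" using *(1) by (auto simp: both_ways_def)
    from T[OF this, of "g v"] show ?case using * 2(2) pairing(1)[OF *(1)] by (simp add: bij_is_inj)
  qed
  have self: "((i, f, v), (i, f, v)) \<in> arc_equiv \<Phi>"
    using equiv_class_self[OF equiv_arc] by auto
  show ?thesis
  proof (cases "unpaired_face \<Phi> (i, f)")
    case True
    have "arc_equiv \<Phi> `` {(i, f, v)} = {(i, f, v)}"
      using closed[of _ "{(i, f, v)}"] True self unpaired_face_iff[of i f] by auto
    then show ?thesis using True by simp
  next
    case False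
    then obtain j g where jg: "(i, f, j, g) \<in> both_ways \<Phi>" by (auto simp: unpaired_face_iff)
    note rev = both_ways_reverse[OF jg] and bij = both_ways_bij[OF jg]
    let ?T = "{(i, f, v), (j, g f, g v)}"
    have "(j', g' f', g' v') \<in> ?T" if "(i', f', j', g') \<in> both_ways \<Phi>" "(i', f', v') \<in> ?T" for i' f' j' g' v'
    proof (cases "(i', f', v') = (i, f, v)")
      case True
      then show ?thesis using both_ways_unique[OF jg, of j' g'] that(1) by simp
    next
      case False
      then have "(i', f', v') = (j, g f, g v)" using that(2) by blast
      then show ?thesis using both_ways_unique[OF rev, of j' g'] that(1) bij by (simp add: bij_is_inj)
    qed
    then have "arc_equiv \<Phi> `` {(i, f, v)} \<subseteq> ?T" using closed[of _ ?T] by blast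
    moreover have "((i, f, v), (j, g f, g v)) \<in> arc_equiv \<Phi>"
      using jg
    proof (cases rule: both_ways_cases)
      case 1
      then show ?thesis unfolding arc_equiv_def using assms by (intro equiv_closure_base) blast
    next
      case 2
      have gv: "g v \<noteq> g f" "inv g (g x) = x" for x using assms bij by (auto simp: bij_is_inj inj_eq)
      have "((j, g f, g v), (i, inv g (g f), inv g (g v))) \<in> arc_equiv \<Phi>"
        unfolding arc_equiv_def using gv(1) 2(1) by (intro equiv_closure_base) blast
      then show ?thesis using equivE[OF equiv_arc] unfolding gv(2) by (meson symD)
    qed
    ultimately have "arc_equiv \<Phi> `` {(i, f, v)} = ?T" using self by blast
    moreover have "(i, f, v) \<noteq> (j, g f, g v)" using both_ways_neq[OF jg] by blast
    ultimately show ?thesis using False by simp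
  qed
qed

end

section \<open>Unpaired faces around an edge\<close>

lemma remaining_vertex:
  fixes f a b :: 4
  assumes "distinct [f, a, b]"
  obtains h where "- {f, a, b} = {h}"
proof -
  have "card (- {f, a, b}) = 1" using assms by (simp add: card_compl_vertices)
  then show thesis using that by (rule card_1_singletonE)
qed

text \<open>
In \<open>(i, f, a, b)\<close>, the face \<open>f\<close> of tetrahedron \<open>i\<close> is one of the two faces containing the oriented edge
\<open>ab\<close>. Walking around an edge of the complex alternates two involutions: \<open>swap_face\<close> passes through the
tetrahedron to its other face at the edge, and \<open>cross_face\<close> passes through a face into the next
tetrahedron and stays put if the face is unpaired.
\<close>

definition swap_face :: "'t \<times> 4 \<times> 4 \<times> 4 \<Rightarrow> 't \<times> 4 \<times> 4 \<times> 4"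
  where "swap_face = (\<lambda>(i, f, a, b).
    (i, if distinct [f, a, b] then the_elem (- {f, a, b}) else f, a, b))"

lemma swap_face_eq:
  assumes "distinct [f, a, b]"
  obtains h where "swap_face (i, f, a, b) = (i, h, a, b)" "swap_face (i, h, a, b) = (i, f, a, b)"
    "- {a, b} = {f, h}" "f \<noteq> h"
proof -
  obtain h where h: "- {f, a, b} = {h}" using remaining_vertex[OF assms] .
  have "h \<in> - {f, a, b}" unfolding h by simp
  then have d: "distinct [h, a, b]" "h \<noteq> f" using assms by auto
  moreover have "- {h, a, b} = {f}" using h d assms by auto
  moreover have "- {a, b} = {f, h}" using h d assms by auto
  ultimately show thesis using that[of h] assms h by (simp add: swap_face_def)
qed

lemma swap_face_swap_face: "swap_face (swap_face x) = x"
proof (cases x)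
  case (fields i f a b)
  show ?thesis
  proof (cases "distinct [f, a, b]")
    case True
    from swap_face_eq[OF this, of i] obtain h
      where "swap_face (i, f, a, b) = (i, h, a, b)" "swap_face (i, h, a, b) = (i, f, a, b)" .
    then show ?thesis by (simp add: fields)
  qed (auto simp: fields swap_face_def)
qed

definition cross_face :: "'t pairing set \<Rightarrow> 't \<times> 4 \<times> 4 \<times> 4 \<Rightarrow> 't \<times> 4 \<times> 4 \<times> 4"
  where "cross_face \<Phi> = (\<lambda>(i, f, a, b). if unpaired_face \<Phi> (i, f) then (i, f, a, b)
    else THE y. \<exists>j g. (i, f, j, g) \<in> both_ways \<Phi> \<and> y = (j, g f, g a, g b))"

definition free_faces :: "'t pairing set \<Rightarrow> 't \<times> 4 \<times> 4 \<Rightarrow> 4 set"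
  where "free_faces \<Phi> = (\<lambda>(i, a, b). {f. f \<noteq> a \<and> f \<noteq> b \<and> unpaired_face \<Phi> (i, f)})"

context pseudomanifold
begin

lemma cross_face_paired:
  assumes "(i, f, j, g) \<in> both_ways \<Phi>"
  shows "cross_face \<Phi> (i, f, a, b) = (j, g f, g a, g b)"
proof -
  have "(THE y. \<exists>j g. (i, f, j, g) \<in> both_ways \<Phi> \<and> y = (j, g f, g a, g b)) = (j, g f, g a, g b)"
    using assms both_ways_unique[OF assms] by (intro the_equality) blast+
  then show ?thesis using assms by (auto simp: cross_face_def unpaired_face_iff)
qed

lemma cross_face_unpaired: "unpaired_face \<Phi> (i, f) \<Longrightarrow> cross_face \<Phi> (i, f, a, b) = (i, f, a, b)"
  by (simp add: cross_face_def)

lemma cross_face_fixed_iff: "cross_face \<Phi> (i, f, a, b) = (i, f, a, b) \<longleftrightarrow> unpaired_face \<Phi> (i, f)"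
proof (cases "unpaired_face \<Phi> (i, f)")
  case False
  then obtain j g where jg: "(i, f, j, g) \<in> both_ways \<Phi>" by (auto simp: unpaired_face_iff)
  show ?thesis using False both_ways_neq[OF jg] unfolding cross_face_paired[OF jg] by auto
qed (simp add: cross_face_unpaired)

lemma cross_face_cross_face: "cross_face \<Phi> (cross_face \<Phi> x) = x"
proof (cases x)
  case (fields i f a b)
  show ?thesis
  proof (cases "unpaired_face \<Phi> (i, f)")
    case False
    then obtain j g where jg: "(i, f, j, g) \<in> both_ways \<Phi>" by (auto simp: unpaired_face_iff)
    show ?thesis
      unfolding fields cross_face_paired[OF jg] cross_face_paired[OF both_ways_reverse[OF jg]]
      using both_ways_bij[OF jg] by (simp add: bij_is_inj)
  qed (simp add: fields cross_face_unpaired)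
qed

text \<open>
The tetrahedra around an edge form either a cycle or a path; on the boundary it is a path, whose two ends
are the unpaired faces. Formally the faces around the edge form one orbit of the involutions
\<open>swap_face\<close> and \<open>cross_face\<close>, and the unpaired faces are the fixed points of the latter. If one tetrahedron
meets the edge class in several edges, these count separately.
\<close>

lemma card_free_faces_of_boundary_class:
  assumes ab: "a \<noteq> b" and C: "C = oriented_edge_equiv \<Phi> `` {(i, a, b)}"
    and free: "w0 \<in> C" "f0 \<in> free_faces \<Phi> w0"
  shows "(\<Sum>w\<in>C. card (free_faces \<Phi> w)) = 2"
proof -
  define S where "S = {(j, f, c, d). (j, c, d) \<in> C \<and> f \<noteq> c \<and> f \<noteq> d}"
  have neq: "c \<noteq> d" if "(j, c, d) \<in> C" for j c d
    using that oriented_edge_neq ab unfolding C by blast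
  have closed: "w' \<in> C" if "w \<in> C" "(w, w') \<in> oriented_edge_equiv \<Phi>" for w w'
    using oriented_edge_trans[OF _ that(2), of "(i, a, b)"] that(1) unfolding C by simp
  obtain j0 c0 d0 where w0: "w0 = (j0, c0, d0)" by (cases w0)
  have "card {x \<in> S. cross_face \<Phi> x = x} = 2"
  proof (rule card_fixed_points_of_dihedral_orbit[of swap_face])
    show "swap_face (swap_face x) = x" for x :: "'t \<times> 4 \<times> 4 \<times> 4" by (rule swap_face_swap_face)
    show "cross_face \<Phi> (cross_face \<Phi> x) = x" for x by (rule cross_face_cross_face)
    show "(j0, f0, c0, d0) \<in> S" "cross_face \<Phi> (j0, f0, c0, d0) = (j0, f0, c0, d0)"
      using free by (auto simp: S_def w0 free_faces_def cross_face_unpaired)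
    show "swap_face x \<in> S \<and> swap_face x \<noteq> x" if x: "x \<in> S" for x
    proof -
      obtain j f c d where x: "x = (j, f, c, d)" "(j, c, d) \<in> C" "f \<noteq> c" "f \<noteq> d"
        using x unfolding S_def by blast
      then have "distinct [f, c, d]" using neq by auto
      from swap_face_eq[OF this, of j] obtain h
        where h: "swap_face (j, f, c, d) = (j, h, c, d)" "- {c, d} = {f, h}" "f \<noteq> h" .
      have "h \<in> - {c, d}" unfolding h(2) by simp
      then show ?thesis using x(1,2) h(1,3) by (simp add: S_def)
    qed
    show "cross_face \<Phi> x \<in> S" if x: "x \<in> S" for x
    proof -
      obtain j f c d where x: "x = (j, f, c, d)" "(j, c, d) \<in> C" "f \<noteq> c" "f \<noteq> d"
        using x unfolding S_def by blast
      show ?thesis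
      proof (cases "unpaired_face \<Phi> (j, f)")
        case False
        then obtain k g where kg: "(j, f, k, g) \<in> both_ways \<Phi>" by (auto simp: unpaired_face_iff)
        have "(k, g c, g d) \<in> C"
          using x(3,4) neq[OF x(2)] by (intro closed[OF x(2)] oriented_edge_step[OF kg]) simp_all
        then show ?thesis
          unfolding x(1) cross_face_paired[OF kg]
          using x both_ways_bij[OF kg] by (auto simp: S_def bij_is_inj inj_eq)
      qed (use \<open>x \<in> S\<close> x in \<open>simp add: cross_face_unpaired\<close>)
    qed
    \<comment> \<open>a set closed under both involutions contains, with one face at an edge, all faces around it\<close>
    show "S \<subseteq> T" if T: "(j0, f0, c0, d0) \<in> T" "swap_face ` T \<subseteq> T" "cross_face \<Phi> ` T \<subseteq> T" for T
    proof -
      have both: "\<forall>f. f \<noteq> c \<longrightarrow> f \<noteq> d \<longrightarrow> (j, f, c, d) \<in> T"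
        if "(j, h, c, d) \<in> T" "h \<noteq> c" "h \<noteq> d" "c \<noteq> d" for j h c d
      proof -
        have "distinct [h, c, d]" using that by simp
        from swap_face_eq[OF this, of j] obtain h'
          where h': "swap_face (j, h, c, d) = (j, h', c, d)" "- {c, d} = {h, h'}" .
        have "(j, h', c, d) \<in> T" using T(2) that(1) h'(1) by (metis image_subset_iff)
        moreover have "f = h \<or> f = h'" if "f \<noteq> c" "f \<noteq> d" for f
        proof -
          have "f \<in> - {c, d}" using that by simp
          then show ?thesis unfolding h'(2) by simp
        qed
        ultimately show ?thesis using that(1) by metis
      qed
      have all: "\<forall>f. f \<noteq> c \<longrightarrow> f \<noteq> d \<longrightarrow> (j, f, c, d) \<in> T"
        if "((j0, c0, d0), (j, c, d)) \<in> oriented_edge_equiv \<Phi>" for j c d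
      proof -
        define P where "P = (\<lambda>(j, c, d). \<forall>f. f \<noteq> c \<longrightarrow> f \<noteq> d \<longrightarrow> (j, f, c, d) \<in> T)"
        have "P (j, c, d)"
          using that
        proof (rule oriented_edge_closed)
          show "P (j0, c0, d0)"
            using both[OF T(1)] free(2) neq[OF free(1)[unfolded w0]]
            by (simp add: P_def w0 free_faces_def)
        next
          fix i f j g a b
          assume *: "(i, f, j, g) \<in> both_ways \<Phi>" "a \<noteq> f" "b \<noteq> f" "a \<noteq> b" "P (i, a, b)"
          have "(i, f, a, b) \<in> T" using * by (simp add: P_def)
          then have "(j, g f, g a, g b) \<in> T"
            using T(3) cross_face_paired[OF *(1)] by (metis image_subset_iff)
          moreover have "g x = g y \<longleftrightarrow> x = y" for x y
            using both_ways_bij[OF *(1)] by (simp add: bij_is_inj inj_eq)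
          ultimately show "P (j, g a, g b)" using both[of j "g f" "g a" "g b"] * by (simp add: P_def)
        qed
        then show ?thesis by (simp add: P_def)
      qed
      have "((j0, c0, d0), w) \<in> oriented_edge_equiv \<Phi>" if "w \<in> C" for w
        using oriented_edge_trans[OF oriented_edge_sym, of "(i, a, b)" "(j0, c0, d0)" w] that free(1)
        unfolding C w0 by simp
      then show ?thesis using all by (auto simp: S_def)
    qed
  qed
  moreover have "{x \<in> S. cross_face \<Phi> x = x}
      = (\<lambda>((j, c, d), f). (j, f, c, d)) ` (SIGMA w:C. free_faces \<Phi> w)"
  proof (intro set_eqI)
    fix x :: "'t \<times> 4 \<times> 4 \<times> 4"
    obtain j f c d where x: "x = (j, f, c, d)" by (cases x)
    have "x \<in> {x \<in> S. cross_face \<Phi> x = x} \<longleftrightarrow> ((j, c, d), f) \<in> (SIGMA w:C. free_faces \<Phi> w)"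
      by (auto simp: x S_def free_faces_def cross_face_fixed_iff)
    also have "\<dots> \<longleftrightarrow> x \<in> (\<lambda>((j, c, d), f). (j, f, c, d)) ` (SIGMA w:C. free_faces \<Phi> w)"
      unfolding x by force
    finally show "x \<in> {x \<in> S. cross_face \<Phi> x = x} \<longleftrightarrow>
      x \<in> (\<lambda>((j, c, d), f). (j, f, c, d)) ` (SIGMA w:C. free_faces \<Phi> w)" .
  qed
  moreover have "card ((\<lambda>((j, c, d), f). (j, f, c, d)) ` (SIGMA w:C. free_faces \<Phi> w))
      = card (SIGMA w:C. free_faces \<Phi> w)"
    by (rule card_image) (auto simp: inj_on_def)
  ultimately show ?thesis by simp
qed

lemma sum_card_free_faces:
  assumes "a \<noteq> b"
  shows "(\<Sum>w\<in>oriented_edge_equiv \<Phi> `` {(i, a, b)}. card (free_faces \<Phi> w))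
    = (if boundary_edge \<Phi> (edge_equiv \<Phi> `` {(i, edge_between a b)}) then 2 else 0)"
proof -
  let ?C = "oriented_edge_equiv \<Phi> `` {(i, a, b)}"
  let ?E = "edge_equiv \<Phi> `` {(i, edge_between a b)}"
  let ?h = "\<lambda>(j, c, d). (j, edge_between c d)"
  have E: "?E = ?h ` ?C" using edge_class_bij[OF assms] by (simp add: bij_betw_def)
  have ends: "ends (edge_between c d) = {c, d}" if "(j, c, d) \<in> ?C" for j c d
    using that oriented_edge_neq assms by (auto simp: ends_edge_between)
  have "boundary_edge \<Phi> ?E \<longleftrightarrow>
      (\<exists>w\<in>?C. case ?h w of (j, e) \<Rightarrow> \<exists>f. f \<notin> ends e \<and> unpaired_face \<Phi> (j, f))"
    unfolding boundary_edge_def E by simp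
  also have "\<dots> \<longleftrightarrow> (\<exists>w\<in>?C. \<exists>f. f \<in> free_faces \<Phi> w)"
  proof (rule bex_cong[OF refl])
    fix w assume w: "w \<in> ?C"
    obtain j c d where "w = (j, c, d)" by (cases w)
    then show "(case ?h w of (j, e) \<Rightarrow> \<exists>f. f \<notin> ends e \<and> unpaired_face \<Phi> (j, f)) \<longleftrightarrow>
        (\<exists>f. f \<in> free_faces \<Phi> w)"
      using ends[of j c d] w by (simp add: free_faces_def)
  qed
  finally have boundary: "boundary_edge \<Phi> ?E \<longleftrightarrow> (\<exists>w\<in>?C. \<exists>f. f \<in> free_faces \<Phi> w)" .
  show ?thesis
  proof (cases "boundary_edge \<Phi> ?E")
    case True
    then obtain w f where "w \<in> ?C" "f \<in> free_faces \<Phi> w" using boundary by blast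
    from card_free_faces_of_boundary_class[OF assms refl this] show ?thesis using True by simp
  next
    case False
    then have "free_faces \<Phi> w = {}" if "w \<in> ?C" for w using boundary that by blast
    then have "(\<Sum>w\<in>?C. card (free_faces \<Phi> w)) = 0" by (intro sum.neutral) simp
    then show ?thesis using False by simp
  qed
qed

end

section \<open>The Euler characteristic of a vertex link\<close>

definition corner_indicator :: "('t \<times> 4) set \<Rightarrow> 't \<times> 4 \<Rightarrow> real"
  where "corner_indicator x p = (if p \<in> x then 1 else 0)"

lemma sum_corner_points:
  fixes x :: "('t::finite \<times> 4) set" and F :: "'t \<times> 4 \<times> 4 \<Rightarrow> 'a::comm_monoid_add"
  shows "(\<Sum>w\<in>{(i, v, b). (i, v) \<in> x \<and> b \<noteq> v}. F w) = (\<Sum>p\<in>x. \<Sum>b\<in>- {snd p}. F (fst p, snd p, b))"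
proof -
  have "(\<Sum>w\<in>{(i, v, b). (i, v) \<in> x \<and> b \<noteq> v}. F w)
      = (\<Sum>(p, b)\<in>(SIGMA p:x. - {snd p}). F (fst p, snd p, b))"
    by (rule sum.reindex_bij_witness[of _ "\<lambda>(p, b). (fst p, snd p, b)" "\<lambda>(i, v, b). ((i, v), b)"]) auto
  then show ?thesis by (simp add: sum.Sigma)
qed

lemma sum_corner_arcs:
  fixes x :: "('t::finite \<times> 4) set" and F :: "'t \<times> 4 \<times> 4 \<Rightarrow> 'a::comm_monoid_add"
  shows "(\<Sum>w\<in>{(i, f, v). (i, v) \<in> x \<and> f \<noteq> v}. F w) = (\<Sum>p\<in>x. \<Sum>f\<in>- {snd p}. F (fst p, f, snd p))"
proof -
  have "(\<Sum>w\<in>{(i, f, v). (i, v) \<in> x \<and> f \<noteq> v}. F w)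
      = (\<Sum>(p, f)\<in>(SIGMA p:x. - {snd p}). F (fst p, f, snd p))"
    by (rule sum.reindex_bij_witness[of _ "\<lambda>(p, f). (fst p, f, snd p)" "\<lambda>(i, f, v). ((i, v), f)"]) auto
  then show ?thesis by (simp add: sum.Sigma)
qed

context pseudomanifold
begin

lemma corner_indicator_constant:
  assumes "x \<in> vertices \<Phi>" "(p, q) \<in> corner_equiv \<Phi>"
  shows "corner_indicator x p = corner_indicator x q"
proof -
  obtain r where "x = corner_equiv \<Phi> `` {r}" using assms(1) by (auto simp: vertices_def quotient_def)
  then have "p \<in> x \<longleftrightarrow> q \<in> x"
    using assms(2) equiv_class_eq_iff[OF equiv_corner] by auto
  then show ?thesis by (simp add: corner_indicator_def)
qed

lemma corner_step:
  assumes "x \<in> vertices \<Phi>" "(i, f, j, g) \<in> \<Phi>" "v \<noteq> f"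
  shows "(j, g v) \<in> x \<longleftrightarrow> (i, v) \<in> x"
proof -
  have "((i, v), (j, g v)) \<in> corner_equiv \<Phi>"
    unfolding corner_equiv_def using assms by (intro equiv_closure_base) blast
  from corner_indicator_constant[OF assms(1) this] show ?thesis
    by (simp add: corner_indicator_def split: if_splits)
qed

lemma link_points_closed:
  assumes "x \<in> vertices \<Phi>"
  shows "oriented_edge_equiv \<Phi> `` {(i, v, b). (i, v) \<in> x \<and> b \<noteq> v} \<subseteq> {(i, v, b). (i, v) \<in> x \<and> b \<noteq> v}"
proof -
  define h where "h = (\<lambda>(i, v, b). (i, v) \<in> x \<and> b \<noteq> v)"
  have "h w = h w'" if "(w, w') \<in> oriented_edge_equiv \<Phi>" for w w'
    using that unfolding oriented_edge_equiv_def
  proof (rule equiv_closure_invariant, clarify)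
    fix i f j g a b assume *: "(i, f, j, g) \<in> \<Phi>" "a \<noteq> f" "b \<noteq> f" "a \<noteq> (b :: 4)"
    have "g a \<noteq> g b" using pairing(1)[OF *(1)] *(4) by (metis bij_is_inj injD)
    then show "h (i, a, b) = h (j, g a, g b)"
      using corner_step[OF assms *(1,2)] *(4) by (auto simp: h_def)
  qed
  moreover have "{(i, v, b). (i, v) \<in> x \<and> b \<noteq> v} = Collect h" by (auto simp: h_def)
  ultimately show ?thesis by auto
qed

lemma link_arcs_closed:
  assumes "x \<in> vertices \<Phi>"
  shows "arc_equiv \<Phi> `` {(i, f, v). (i, v) \<in> x \<and> f \<noteq> v} \<subseteq> {(i, f, v). (i, v) \<in> x \<and> f \<noteq> v}"
proof -
  define h where "h = (\<lambda>(i, f, v). (i, v) \<in> x \<and> f \<noteq> v)"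
  have "h w = h w'" if "(w, w') \<in> arc_equiv \<Phi>" for w w'
    using that unfolding arc_equiv_def
  proof (rule equiv_closure_invariant, clarify)
    fix i f j g v assume *: "(i, f, j, g) \<in> \<Phi>" "v \<noteq> f"
    have "g f \<noteq> g v" using pairing(1)[OF *(1)] *(2) by (metis bij_is_inj injD)
    then show "h (i, f, v) = h (j, g f, g v)"
      using corner_step[OF assms *(1,2)] *(2) by (auto simp: h_def)
  qed
  moreover have "{(i, f, v). (i, v) \<in> x \<and> f \<noteq> v} = Collect h" by (auto simp: h_def)
  ultimately show ?thesis by auto
qed

text \<open>
The number of boundary arcs of the link of \<open>x\<close>: the sides of its triangles lying in unpaired faces.
\<close>

definition free_sides :: "('t \<times> 4) set \<Rightarrow> nat"
  where "free_sides x = (\<Sum>p\<in>x. card {f. f \<noteq> snd p \<and> unpaired_face \<Phi> (fst p, f)})"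

text \<open>
Each of the \<open>card x\<close> triangles has three sides, and a side is shared by two triangles unless it lies in an
unpaired face. So counting sides counts inner arcs twice and boundary arcs once.
\<close>

lemma card_link_arcs:
  assumes "x \<in> vertices \<Phi>"
  shows "2 * real (card (link_arcs \<Phi> x)) = 3 * real (card x) + real (free_sides x)"
proof -
  let ?D = "{(i, f, v). (i, v) \<in> x \<and> f \<noteq> v}"
  have "real (card (link_arcs \<Phi> x)) = (\<Sum>C\<in>?D // arc_equiv \<Phi>. 1)" by (simp add: link_arcs_def)
  also have "\<dots> = (\<Sum>w\<in>?D. 1 / real (card (arc_equiv \<Phi> `` {w})))"
    by (rule sum_over_classes_averaged[OF equiv_arc finite subset_UNIV link_arcs_closed[OF assms]])
  also have "\<dots> = (\<Sum>p\<in>x. \<Sum>f\<in>- {snd p}. 1 / real (card (arc_equiv \<Phi> `` {(fst p, f, snd p)})))"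
    by (rule sum_corner_arcs)
  also have "\<dots> = (\<Sum>p\<in>x. 3 / 2 + real (card {f. f \<noteq> snd p \<and> unpaired_face \<Phi> (fst p, f)}) / 2)"
  proof (intro sum.cong refl)
    fix p assume "p \<in> x"
    have "(\<Sum>f\<in>- {snd p}. 1 / real (card (arc_equiv \<Phi> `` {(fst p, f, snd p)})))
        = (\<Sum>f\<in>- {snd p}. 1 / 2 + (if unpaired_face \<Phi> (fst p, f) then 1 / 2 else 0))"
      by (intro sum.cong refl) (auto simp: card_arc_class)
    also have "\<dots> = 3 / 2 + (\<Sum>f\<in>- {snd p}. if unpaired_face \<Phi> (fst p, f) then 1 / 2 else 0)"
      by (simp add: sum.distrib card_compl_vertices)
    also have "(\<Sum>f\<in>- {snd p}. if unpaired_face \<Phi> (fst p, f) then 1 / 2 else (0::real))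
        = (\<Sum>f | f \<noteq> snd p \<and> unpaired_face \<Phi> (fst p, f). 1 / 2)"
      by (subst sum.inter_filter[symmetric]) (auto intro!: sum.cong)
    finally show "(\<Sum>f\<in>- {snd p}. 1 / real (card (arc_equiv \<Phi> `` {(fst p, f, snd p)})))
        = 3 / 2 + real (card {f. f \<noteq> snd p \<and> unpaired_face \<Phi> (fst p, f)}) / 2" by simp
  qed
  finally show ?thesis by (simp add: free_sides_def sum.distrib sum_divide_distrib[symmetric])
qed

text \<open>
Every boundary arc has two end points. The left-hand side counts incidences of boundary arcs with
corners of triangles, grouped by corner.
\<close>

lemma sum_free_faces_link_points:
  "(\<Sum>w\<in>{(i, v, b). (i, v) \<in> x \<and> b \<noteq> v}. card (free_faces \<Phi> w)) = 2 * free_sides x"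
proof -
  have "(\<Sum>b\<in>- {snd p}. card (free_faces \<Phi> (fst p, snd p, b)))
      = 2 * card {f. f \<noteq> snd p \<and> unpaired_face \<Phi> (fst p, f)}" for p :: "'t \<times> 4"
  proof -
    let ?U = "{f. f \<noteq> snd p \<and> unpaired_face \<Phi> (fst p, f)}"
    have "(\<Sum>b\<in>- {snd p}. card (free_faces \<Phi> (fst p, snd p, b)))
        = (\<Sum>b\<in>- {snd p}. \<Sum>f | f \<in> ?U \<and> f \<noteq> b. 1)"
      by (intro sum.cong refl) (auto simp: free_faces_def intro!: arg_cong[of _ _ card])
    also have "\<dots> = (\<Sum>f\<in>?U. \<Sum>b | b \<in> - {snd p} \<and> f \<noteq> b. 1)"
      by (rule sum.swap_restrict) auto
    also have "\<dots> = (\<Sum>f\<in>?U. 2)"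
    proof (intro sum.cong refl)
      fix f assume "f \<in> ?U"
      moreover have "{b. b \<in> - {snd p} \<and> f \<noteq> b} = - {f, snd p}" by blast
      ultimately show "(\<Sum>b | b \<in> - {snd p} \<and> f \<noteq> b. 1) = (2::nat)"
        by (simp add: card_compl_vertices)
    qed
    finally show ?thesis by simp
  qed
  then show ?thesis by (simp add: sum_corner_points free_sides_def sum_distrib_left)
qed

text \<open>
Each point of the link is an end of an edge of the complex, so the sum on the left is \<open>2 * V - V\<^sub>b\<close>, where
\<open>V\<close> and \<open>V\<^sub>b\<close> are the numbers of points and boundary points. Let the link have \<open>M\<close> arcs, of which \<open>M\<^sub>b\<close> lie in
the boundary, and \<open>F = card x\<close> triangles. Then \<open>2 * M = 3 * F + M\<^sub>b\<close>, and \<open>V\<^sub>b = M\<^sub>b\<close> because boundary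
arcs end at each boundary point exactly twice and each boundary arc has two ends. Hence
\<open>2 * (V - M + F) = 2 * V - M\<^sub>b - F\<close> is the left-hand side.
\<close>

lemma euler_char_link:
  assumes x: "x \<in> vertices \<Phi>"
  shows "(\<Sum>E\<in>edges \<Phi>. (if boundary_edge \<Phi> E then 1 else 2) * class_value (ends_sum (corner_indicator x)) E)
    - card x = 2 * real_of_int (link_euler_char \<Phi> x)"
proof -
  let ?r = "oriented_edge_equiv \<Phi>" and ?y = "corner_indicator x"
  let ?D = "{(i, v, b). (i, v) \<in> x \<and> b \<noteq> v}"
  define m :: "('t \<times> tedge) set \<Rightarrow> real" where "m E = (if boundary_edge \<Phi> E then 1 else 2)" for E
  \<comment> \<open>By \<open>sum_card_free_faces\<close>, \<open>m\<close> and \<open>m'\<close> agree on an edge class and its orientations.\<close>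
  define m' :: "('t \<times> 4 \<times> 4) set \<Rightarrow> real" where "m' C = 2 - real (\<Sum>w\<in>C. card (free_faces \<Phi> w)) / 2" for C
  define F where "F w = m (edge_equiv \<Phi> `` {w}) / card (edge_equiv \<Phi> `` {w})" for w
  have F: "F (i, edge_between v b) = m' (?r `` {(i, v, b)}) / card (?r `` {(i, v, b)})" if "v \<noteq> b" for i v b
  proof -
    have "card (edge_equiv \<Phi> `` {(i, edge_between v b)}) = card (?r `` {(i, v, b)})"
      using bij_betw_same_card[OF edge_class_bij[OF that]] by simp
    moreover have "m (edge_equiv \<Phi> `` {(i, edge_between v b)}) = m' (?r `` {(i, v, b)})"
      unfolding m_def m'_def sum_card_free_faces[OF that] by simp
    ultimately show ?thesis by (simp add: F_def)
  qed
  have "(\<Sum>E\<in>edges \<Phi>. m E * class_value (ends_sum ?y) E)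
      = (\<Sum>w\<in>UNIV. m (edge_equiv \<Phi> `` {w}) * class_value (ends_sum ?y) (edge_equiv \<Phi> `` {w})
          / card (edge_equiv \<Phi> `` {w}))"
    unfolding edges_def by (rule sum_over_classes_averaged[OF equiv_edge]) auto
  also have "\<dots> = (\<Sum>w\<in>UNIV. F w * ends_sum ?y w)"
  proof (intro sum.cong refl)
    fix w
    have "class_value (ends_sum ?y) (edge_equiv \<Phi> `` {w}) = ends_sum ?y w"
      by (rule class_value_class[OF equiv_edge ends_sum_constant[OF corner_indicator_constant[OF x]] UNIV_I])
    then show "m (edge_equiv \<Phi> `` {w}) * class_value (ends_sum ?y) (edge_equiv \<Phi> `` {w})
          / card (edge_equiv \<Phi> `` {w}) = F w * ends_sum ?y w" by (simp add: F_def)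
  qed
  also have "\<dots> = (\<Sum>i\<in>UNIV. \<Sum>e\<in>UNIV. F (i, e) * ends_sum ?y (i, e))"
    by (simp add: sum.cartesian_product UNIV_Times_UNIV)
  also have "\<dots> = (\<Sum>i\<in>UNIV. \<Sum>e\<in>UNIV. \<Sum>v\<in>ends e. F (i, e) * ?y (i, v))"
    by (simp add: ends_sum_def sum_distrib_left)
  also have "\<dots> = (\<Sum>i\<in>UNIV. \<Sum>v\<in>UNIV. \<Sum>b\<in>- {v}. F (i, edge_between v b) * ?y (i, v))"
    by (simp only: sum_edge_ends)
  also have "\<dots> = (\<Sum>p\<in>UNIV. (\<Sum>b\<in>- {snd p}. F (fst p, edge_between (snd p) b)) * ?y p)"
    by (simp add: sum.cartesian_product UNIV_Times_UNIV sum_distrib_right case_prod_beta)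
  also have "\<dots> = (\<Sum>p\<in>x. \<Sum>b\<in>- {snd p}. F (fst p, edge_between (snd p) b))"
    by (rule sum.mono_neutral_cong_right) (auto simp: corner_indicator_def)
  also have "\<dots> = (\<Sum>p\<in>x. \<Sum>b\<in>- {snd p}. m' (?r `` {(fst p, snd p, b)}) / card (?r `` {(fst p, snd p, b)}))"
    by (intro sum.cong refl F) auto
  also have "\<dots> = (\<Sum>w\<in>?D. m' (?r `` {w}) / card (?r `` {w}))"
    by (rule sum_corner_points[symmetric])
  also have "\<dots> = (\<Sum>C\<in>?D // ?r. m' C)"
    by (rule sum_over_classes_averaged[symmetric, OF equiv_oriented_edge finite subset_UNIV link_points_closed[OF x]])
  also have "\<dots> = 2 * real (card (link_points \<Phi> x)) - real (\<Sum>C\<in>?D // ?r. \<Sum>w\<in>C. card (free_faces \<Phi> w)) / 2"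
    by (simp add: m'_def sum_subtractf sum_divide_distrib link_points_def)
  also have "(\<Sum>C\<in>?D // ?r. \<Sum>w\<in>C. card (free_faces \<Phi> w)) = (\<Sum>w\<in>?D. card (free_faces \<Phi> w))"
    by (rule sum_over_classes[OF equiv_oriented_edge finite subset_UNIV link_points_closed[OF x]])
  also have "\<dots> = 2 * free_sides x" by (rule sum_free_faces_link_points)
  finally show ?thesis
    using card_link_arcs[OF x] by (simp add: m_def link_euler_char_def)
qed

end

section \<open>The value of the area-curvature functional on a vertex link\<close>

lemma axis_component: "axis k x $ i = (if i = k then x else 0)"
  by (simp add: axis_def)

lemma W_tet_component:
  "W_tet i $ Inr (j, v) = (if i = j then 1 else 0)"
  "W_tet i $ Inl (j, q) = (if i = j then -1 else 0)"
  by (cases "i = j"; simp add: W_tet_def axis_component)+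

lemma W_edge_component:
  "W_edge E $ Inr (j, v) = (\<Sum>w\<in>E. if fst w = j \<and> v \<in> ends (snd w) then 1 else 0)"
  "W_edge E $ Inl (j, q) = - (\<Sum>w\<in>E. if fst w = j \<and> quad_facing (snd w) = q then 1 else 0)"
proof -
  have "((\<Sum>u\<in>ends e. tri_vec (i, u)) - quad_vec (i, quad_facing e)) $ Inr (j, v)
      = (if i = j \<and> v \<in> ends e then 1 else 0)" for i e
    by (cases "i = j") (auto simp: axis_component)
  then show "W_edge E $ Inr (j, v) = (\<Sum>w\<in>E. if fst w = j \<and> v \<in> ends (snd w) then 1 else 0)"
    by (simp add: W_edge_def case_prod_beta)
  have "((\<Sum>u\<in>ends e. tri_vec (i, u)) - quad_vec (i, quad_facing e)) $ Inl (j, q)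
      = - (if i = j \<and> quad_facing e = q then 1 else 0)" for i e
    by (auto simp: axis_component)
  then show "W_edge E $ Inl (j, q) = - (\<Sum>w\<in>E. if fst w = j \<and> quad_facing (snd w) = q then 1 else 0)"
    by (simp add: W_edge_def case_prod_beta sum_negf)
qed

lemma link_coord_component:
  "link_coord x $ Inr p = corner_indicator x p" "link_coord x $ Inl q = 0"
  by (simp_all add: link_coord_def axis_component corner_indicator_def)

lemma sum_tet_restrict:
  fixes F :: "'t::finite \<times> tedge \<Rightarrow> real"
  shows "(\<Sum>w\<in>UNIV. F w * (if fst w = j \<and> P (snd w) then 1 else 0)) = (\<Sum>e | P e. F (j, e))"
proof -
  have "(\<Sum>w\<in>UNIV. F w * (if fst w = j \<and> P (snd w) then 1 else 0))
      = (\<Sum>w\<in>Pair j ` {e. P e}. F w)"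
    by (rule sum.mono_neutral_cong_right) auto
  also have "\<dots> = (\<Sum>e | P e. F (j, e))"
    by (subst sum.reindex) (auto simp: inj_on_def)
  finally show ?thesis .
qed

context pseudomanifold
begin

lemma sum_over_edge_classes:
  "(\<Sum>E\<in>edges \<Phi>. z E * (\<Sum>w\<in>E. F w)) = (\<Sum>w\<in>UNIV. z (edge_equiv \<Phi> `` {w}) * (F w :: real))"
  unfolding edges_def sum_distrib_left
  using sum_over_classes[OF equiv_edge, of UNIV "\<lambda>E w. z E * F w"] by simp

lemma W_combination_component:
  fixes w :: "'t \<Rightarrow> real"
  assumes "s = (\<Sum>i\<in>UNIV. w i *\<^sub>R W_tet i) + (\<Sum>E\<in>edges \<Phi>. z E *\<^sub>R W_edge E)"
  shows "s $ Inr (i, v) = w i + (\<Sum>e | v \<in> ends e. z (edge_equiv \<Phi> `` {(i, e)}))"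
    and "s $ Inl (i, quad_facing e)
      = - (w i + (z (edge_equiv \<Phi> `` {(i, e)}) + z (edge_equiv \<Phi> `` {(i, opposite e)})))"
proof -
  have "(\<Sum>E\<in>edges \<Phi>. z E * W_edge E $ Inr (i, v)) = (\<Sum>e | v \<in> ends e. z (edge_equiv \<Phi> `` {(i, e)}))"
    by (simp only: W_edge_component sum_over_edge_classes
      sum_tet_restrict[where P = "\<lambda>e. v \<in> ends e" and F = "\<lambda>w. z (edge_equiv \<Phi> `` {w})"])
  then show "s $ Inr (i, v) = w i + (\<Sum>e | v \<in> ends e. z (edge_equiv \<Phi> `` {(i, e)}))"
    by (simp add: assms W_tet_component if_distrib[of "\<lambda>a. _ * a"] cong: if_cong)
  have "(\<Sum>E\<in>edges \<Phi>. z E * W_edge E $ Inl (i, quad_facing e))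
      = - (\<Sum>e' | quad_facing e' = quad_facing e. z (edge_equiv \<Phi> `` {(i, e')}))"
    by (simp only: W_edge_component mult_minus_right sum_negf sum_over_edge_classes
      sum_tet_restrict[where P = "\<lambda>e'. quad_facing e' = quad_facing e" and F = "\<lambda>w. z (edge_equiv \<Phi> `` {w})"])
  then show "s $ Inl (i, quad_facing e)
      = - (w i + (z (edge_equiv \<Phi> `` {(i, e)}) + z (edge_equiv \<Phi> `` {(i, opposite e)})))"
    by (simp add: assms W_tet_component sum_edges_facing_quad if_distrib[of "\<lambda>a. _ * a"] cong: if_cong)
qed

text \<open>
The edge coefficients of an expansion in the \<open>W_tet i\<close> and \<open>W_edge E\<close> are read off in any tetrahedron
containing the edge. This is what makes the definite description in the definition of
\<open>chi_area_curvature\<close> meaningful.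
\<close>

lemma W_combination_unique:
  fixes w w' :: "'t \<Rightarrow> real"
  assumes s: "s = (\<Sum>i\<in>UNIV. w i *\<^sub>R W_tet i) + (\<Sum>E\<in>edges \<Phi>. z E *\<^sub>R W_edge E)"
    and s': "s = (\<Sum>i\<in>UNIV. w' i *\<^sub>R W_tet i) + (\<Sum>E\<in>edges \<Phi>. z' E *\<^sub>R W_edge E)"
    and E: "E \<in> edges \<Phi>"
  shows "z E = z' E"
proof -
  obtain i e where ie: "E = edge_equiv \<Phi> `` {(i, e)}"
    using E by (auto simp: edges_def quotient_def)
  let ?z = "\<lambda>e. z (edge_equiv \<Phi> `` {(i, e)}) - z' (edge_equiv \<Phi> `` {(i, e)})"
  have "?z e = 0"
  proof (rule edge_function_zero_if_constant_sums[where w = "w i - w' i" and z = ?z])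
    show "w i - w' i + (\<Sum>e | v \<in> ends e. ?z e) = 0" for v
      using W_combination_component(1)[OF s, of i v] W_combination_component(1)[OF s', of i v]
      by (simp add: sum_subtractf)
    show "w i - w' i + (?z e + ?z (opposite e)) = 0" for e
      using W_combination_component(2)[OF s, of i e] W_combination_component(2)[OF s', of i e]
      by simp
  qed
  then show ?thesis by (simp add: ie)
qed

lemma ends_sum_corner_indicator_value:
  assumes "x \<in> vertices \<Phi>"
  shows "class_value (ends_sum (corner_indicator x)) (edge_equiv \<Phi> `` {w}) = ends_sum (corner_indicator x) w"
  by (rule class_value_class[OF equiv_edge ends_sum_constant[OF corner_indicator_constant[OF assms]] UNIV_I])

text \<open>
Let \<open>y\<close> be the indicator function of the corners in \<open>x\<close>. With coefficient \<open>(y a + y b) / 2\<close> at the edge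
\<open>ab\<close>, two opposite edges contribute minus half of the sum of \<open>y\<close> over the four corners to the
quadrilateral coordinate, and the three edges at \<open>v\<close> contribute \<open>y v\<close> plus this half sum to the triangle
coordinate. The coefficient of \<open>W_tet i\<close> is chosen to cancel the half sum in both.
\<close>

lemma link_coord_eq_W_combination:
  fixes x :: "('t \<times> 4) set"
  assumes "x \<in> vertices \<Phi>"
  shows "link_coord x
    = (\<Sum>i\<in>UNIV. (- (\<Sum>v\<in>UNIV. corner_indicator x (i, v)) / 2) *\<^sub>R W_tet i)
    + (\<Sum>E\<in>edges \<Phi>. (class_value (ends_sum (corner_indicator x)) E / 2) *\<^sub>R W_edge E)"
    (is "_ = ?s")
proof (rule vec_eq_iff[THEN iffD2], rule allI)
  fix k :: "'t disc_type"
  show "link_coord x $ k = ?s $ k"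
  proof (cases k)
    case (Inl iq)
    obtain i e where iq: "iq = (i, quad_facing e)" by (metis prod.exhaust quad_cases)
    show ?thesis
      unfolding Inl iq W_combination_component(2)[OF refl] link_coord_component
        ends_sum_corner_indicator_value[OF assms]
      using ends_sum_opposite[of "corner_indicator x" i e] by (simp add: field_simps)
  next
    case (Inr p)
    obtain i v where p: "p = (i, v)" by (cases p)
    show ?thesis
      unfolding Inr p W_combination_component(1)[OF refl] link_coord_component
        ends_sum_corner_indicator_value[OF assms]
      using sum_ends_sum_at_corner[where y = "corner_indicator x" and i = i and v = v]
      by (simp add: sum_divide_distrib[symmetric] field_simps)
  qed
qed

lemma link_coord_in_solution_space:
  assumes "x \<in> vertices \<Phi>"
  shows "link_coord x \<in> solution_space \<Phi>"
  unfolding solution_space_def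
proof (clarsimp simp: arc_weight_def link_coord_component)
  fix i f j g v assume "(i, f, j, g) \<in> \<Phi>" "v \<noteq> f"
  from corner_step[OF assms this]
  show "corner_indicator x (i, v) = corner_indicator x (j, g v)" by (simp add: corner_indicator_def)
qed

lemma chi_area_curvature_link:
  assumes x: "x \<in> vertices \<Phi>"
  shows "2 * pi * chi_area_curvature \<Phi> A \<kappa> (link_coord x)
    = (\<Sum>p\<in>x. A p) + (\<Sum>E\<in>edges \<Phi>. class_value (ends_sum (corner_indicator x)) E * \<kappa> E)"
proof -
  let ?z = "\<lambda>E. class_value (ends_sum (corner_indicator x)) E / 2"
  let ?rhs = "\<lambda>z. 1 / (2 * pi) * ((\<Sum>p\<in>UNIV. link_coord x $ Inr p * A p) + (\<Sum>E\<in>edges \<Phi>. 2 * z E * \<kappa> E))"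
  have "(THE r. \<exists>w z. link_coord x = (\<Sum>i\<in>UNIV. w i *\<^sub>R W_tet i) + (\<Sum>E\<in>edges \<Phi>. z E *\<^sub>R W_edge E) \<and>
      r = ?rhs z) = ?rhs ?z"
  proof (rule the_equality)
    show "\<exists>w z. link_coord x = (\<Sum>i\<in>UNIV. w i *\<^sub>R W_tet i) + (\<Sum>E\<in>edges \<Phi>. z E *\<^sub>R W_edge E) \<and>
        ?rhs ?z = ?rhs z"
      using link_coord_eq_W_combination[OF x]
      by (intro exI[of _ "\<lambda>i. - (\<Sum>v\<in>UNIV. corner_indicator x (i, v)) / 2"] exI[of _ ?z] conjI refl)
  next
    fix r
    assume "\<exists>w z. link_coord x = (\<Sum>i\<in>UNIV. w i *\<^sub>R W_tet i) + (\<Sum>E\<in>edges \<Phi>. z E *\<^sub>R W_edge E) \<and> r = ?rhs z"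
    then obtain w z
      where wz: "link_coord x = (\<Sum>i\<in>UNIV. w i *\<^sub>R W_tet i) + (\<Sum>E\<in>edges \<Phi>. z E *\<^sub>R W_edge E)"
        and r: "r = ?rhs z" by blast
    have "z E = ?z E" if "E \<in> edges \<Phi>" for E
      using W_combination_unique[OF wz link_coord_eq_W_combination[OF x] that] .
    then have "(\<Sum>E\<in>edges \<Phi>. 2 * z E * \<kappa> E) = (\<Sum>E\<in>edges \<Phi>. 2 * ?z E * \<kappa> E)"
      by (intro sum.cong refl) (simp only:)
    then show "r = ?rhs ?z" unfolding r by (simp only:)
  qed
  then have "chi_area_curvature \<Phi> A \<kappa> (link_coord x) = ?rhs ?z"
    by (simp only: chi_area_curvature_def restrict_apply link_coord_in_solution_space[OF x] if_True)
  moreover have "(\<Sum>p\<in>UNIV. link_coord x $ Inr p * A p) = (\<Sum>p\<in>x. A p)"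
    unfolding link_coord_component
    by (rule sum.mono_neutral_cong_right) (auto simp: corner_indicator_def)
  ultimately show ?thesis by simp
qed

end

section \<open>Angle structures as solutions of a linear system\<close>

definition constraint_row :: "('t::finite \<times> 4) + ('t \<times> tedge) set \<Rightarrow> 't angles"
  where "constraint_row k = (case k of
      Inl p \<Rightarrow> \<Sum>e | snd p \<in> ends e. axis (fst p, e) 1
    | Inr E \<Rightarrow> \<Sum>w\<in>E. axis w 1)"

lemma constraint_row_inner:
  "constraint_row (Inl (i, v)) \<bullet> \<theta> = (\<Sum>e | v \<in> ends e. \<theta> $ (i, e))"
  "constraint_row (Inr E) \<bullet> \<theta> = (\<Sum>w\<in>E. \<theta> $ w)"
  by (simp_all add: constraint_row_def inner_sum_left inner_axis')

context pseudomanifold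
begin

text \<open>
The right-hand sides for which the areas and curvatures equal \<open>A\<close> and \<open>\<kappa>\<close> when the inner products with
\<open>constraint_row\<close> do.
\<close>

definition constraint_rhs :: "('t \<times> 4 \<Rightarrow> real) \<Rightarrow> (('t \<times> tedge) set \<Rightarrow> real)
    \<Rightarrow> ('t \<times> 4) + ('t \<times> tedge) set \<Rightarrow> real"
  where "constraint_rhs A \<kappa> k = (case k of
      Inl p \<Rightarrow> A p + pi
    | Inr E \<Rightarrow> (if boundary_edge \<Phi> E then pi else 2 * pi) - \<kappa> E)"

definition constraints :: "(('t \<times> 4) + ('t \<times> tedge) set) set"
  where "constraints = UNIV <+> edges \<Phi>"

lemma sum_constraints:
  "(\<Sum>k\<in>constraints. F k) = (\<Sum>p\<in>UNIV. F (Inl p)) + (\<Sum>E\<in>edges \<Phi>. F (Inr E))"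
  unfolding constraints_def by (subst sum.Plus) simp_all

lemma angle_structures_eq:
  "angle_structures \<Phi> A \<kappa> = {\<theta>. \<forall>k\<in>constraints. constraint_row k \<bullet> \<theta> = constraint_rhs A \<kappa> k}"
proof -
  have "area \<theta> p = A p \<longleftrightarrow> constraint_row (Inl p) \<bullet> \<theta> = constraint_rhs A \<kappa> (Inl p)" for \<theta> p
    by (cases p) (auto simp: area_def constraint_row_inner constraint_rhs_def)
  moreover have "curvature \<Phi> \<theta> E = \<kappa> E \<longleftrightarrow> constraint_row (Inr E) \<bullet> \<theta> = constraint_rhs A \<kappa> (Inr E)" for \<theta> E
    by (auto simp: curvature_def constraint_row_inner constraint_rhs_def)
  ultimately show ?thesis
    by (auto simp: angle_structures_def constraints_def Plus_def)
qed

text \<open>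
The angle of the wedge \<open>ab\<close> occurs in the two area equations of the corners \<open>a\<close> and \<open>b\<close> and in the equation of
the edge class. So the relation says that the edge coefficient cancels the sum of the two corner
coefficients.
\<close>

lemma constraint_dependency_iff:
  "c \<in> row_dependencies constraints constraint_row \<longleftrightarrow>
    (\<forall>E. E \<notin> edges \<Phi> \<longrightarrow> c $ Inr E = 0) \<and>
    (\<forall>w. c $ Inr (edge_equiv \<Phi> `` {w}) = - ends_sum (\<lambda>p. c $ Inl p) w)"
proof -
  have "(\<Sum>k\<in>constraints. c $ k *\<^sub>R constraint_row k) $ w
      = ends_sum (\<lambda>p. c $ Inl p) w + c $ Inr (edge_equiv \<Phi> `` {w})" for w
  proof -
    obtain i e where w: "w = (i, e)" by (cases w)
    have "(\<Sum>p\<in>UNIV. c $ Inl p * constraint_row (Inl p) $ w) = (\<Sum>p\<in>Pair i ` ends e. c $ Inl p)"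
      by (rule sum.mono_neutral_cong_right)
        (auto simp: constraint_row_def axis_component w image_iff intro!: sum.neutral)
    also have "\<dots> = ends_sum (\<lambda>p. c $ Inl p) w"
      by (simp add: w ends_sum_def sum.reindex inj_on_def)
    finally have 1: "(\<Sum>p\<in>UNIV. c $ Inl p * constraint_row (Inl p) $ w) = ends_sum (\<lambda>p. c $ Inl p) w" .
    have "(\<Sum>E\<in>edges \<Phi>. c $ Inr E * constraint_row (Inr E) $ w)
        = (\<Sum>E\<in>edges \<Phi>. c $ Inr E * (\<Sum>w'\<in>E. if w = w' then 1 else 0))"
      by (simp add: constraint_row_def axis_component)
    also have "\<dots> = (\<Sum>w'\<in>UNIV. c $ Inr (edge_equiv \<Phi> `` {w'}) * (if w = w' then 1 else 0))"
      by (rule sum_over_edge_classes)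
    also have "\<dots> = c $ Inr (edge_equiv \<Phi> `` {w})" by (simp add: if_distrib cong: if_cong)
    finally show ?thesis using 1 by (simp add: sum_constraints)
  qed
  then have "(\<Sum>k\<in>constraints. c $ k *\<^sub>R constraint_row k) = 0 \<longleftrightarrow>
      (\<forall>w. c $ Inr (edge_equiv \<Phi> `` {w}) = - ends_sum (\<lambda>p. c $ Inl p) w)"
    by (auto simp: vec_eq_iff eq_neg_iff_add_eq_0 add.commute)
  moreover have "(\<forall>k. k \<notin> constraints \<longrightarrow> c $ k = 0) \<longleftrightarrow> (\<forall>E. E \<notin> edges \<Phi> \<longrightarrow> c $ Inr E = 0)"
    by (auto simp: constraints_def split_sum_all)
  ultimately show ?thesis by (simp add: row_dependencies_def)
qed

text \<open>
The dependency whose corner coefficients are \<open>1\<close> at the corners in \<open>x\<close> and \<open>0\<close> elsewhere.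
\<close>

definition vertex_dependency :: "('t \<times> 4) set \<Rightarrow> real ^ (('t \<times> 4) + ('t \<times> tedge) set)"
  where "vertex_dependency x = (\<chi> k. case k of
      Inl p \<Rightarrow> corner_indicator x p
    | Inr E \<Rightarrow> if E \<in> edges \<Phi> then - class_value (ends_sum (corner_indicator x)) E else 0)"

definition combine_dependencies :: "real ^ ('t \<times> 4) set \<Rightarrow> real ^ (('t \<times> 4) + ('t \<times> tedge) set)"
  where "combine_dependencies u = (\<Sum>x\<in>vertices \<Phi>. u $ x *\<^sub>R vertex_dependency x)"

lemma sum_corner_indicator:
  "(\<Sum>x\<in>vertices \<Phi>. F x * corner_indicator x p) = F (corner_equiv \<Phi> `` {p})"
proof -
  have "corner_indicator x p = (if corner_equiv \<Phi> `` {p} = x then 1 else 0)" if x: "x \<in> vertices \<Phi>" for x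
  proof -
    obtain q where "x = corner_equiv \<Phi> `` {q}" using x by (auto simp: vertices_def quotient_def)
    then have "p \<in> x \<longleftrightarrow> corner_equiv \<Phi> `` {p} = x"
      using equiv_class_eq_iff[OF equiv_corner, of q p] by auto
    then show ?thesis by (simp add: corner_indicator_def)
  qed
  then have "(\<Sum>x\<in>vertices \<Phi>. F x * corner_indicator x p)
      = (\<Sum>x\<in>vertices \<Phi>. if corner_equiv \<Phi> `` {p} = x then F x else 0)"
    by (intro sum.cong) auto
  also have "\<dots> = F (corner_equiv \<Phi> `` {p})"
    by (simp add: vertices_def quotientI)
  finally show ?thesis .
qed

lemma combine_dependencies_component:
  "combine_dependencies u $ Inl p = u $ (corner_equiv \<Phi> `` {p})"
  "E \<notin> edges \<Phi> \<Longrightarrow> combine_dependencies u $ Inr E = 0"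
  "combine_dependencies u $ Inr (edge_equiv \<Phi> `` {w})
    = - ends_sum (\<lambda>p. u $ (corner_equiv \<Phi> `` {p})) w"
proof -
  show "combine_dependencies u $ Inl p = u $ (corner_equiv \<Phi> `` {p})" for p
    by (simp add: combine_dependencies_def vertex_dependency_def sum_corner_indicator)
  show "E \<notin> edges \<Phi> \<Longrightarrow> combine_dependencies u $ Inr E = 0"
    by (simp add: combine_dependencies_def vertex_dependency_def)
  have "edge_equiv \<Phi> `` {w} \<in> edges \<Phi>" by (simp add: edges_def quotientI)
  then have "combine_dependencies u $ Inr (edge_equiv \<Phi> `` {w})
      = (\<Sum>x\<in>vertices \<Phi>. - (u $ x * ends_sum (corner_indicator x) w))"
    by (simp add: combine_dependencies_def vertex_dependency_def ends_sum_corner_indicator_value)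
  also have "\<dots> = - (\<Sum>v\<in>ends (snd w). \<Sum>x\<in>vertices \<Phi>. u $ x * corner_indicator x (fst w, v))"
    unfolding ends_sum_def case_prod_beta sum_negf sum_distrib_left by (simp add: sum.swap[of _ _ "vertices \<Phi>"])
  also have "\<dots> = - ends_sum (\<lambda>p. u $ (corner_equiv \<Phi> `` {p})) w"
    by (simp add: sum_corner_indicator ends_sum_def case_prod_beta)
  finally show "combine_dependencies u $ Inr (edge_equiv \<Phi> `` {w})
    = - ends_sum (\<lambda>p. u $ (corner_equiv \<Phi> `` {p})) w" .
qed

text \<open>
In a dependency the sum of the two corner coefficients is the same for all edges in an edge class. By
\<open>constant_if_ends_sum_constant\<close> the corner coefficients are then constant on vertex classes, and they
determine the edge coefficients. So dependencies correspond to functions on the vertices.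
\<close>

lemma row_dependencies_eq:
  "row_dependencies constraints constraint_row
    = combine_dependencies ` {u. \<forall>x. x \<notin> vertices \<Phi> \<longrightarrow> u $ x = 0}"
proof (intro equalityI subsetI)
  fix c assume "c \<in> row_dependencies constraints constraint_row"
  then have off: "\<And>E. E \<notin> edges \<Phi> \<Longrightarrow> c $ Inr E = 0"
    and on: "\<And>w. c $ Inr (edge_equiv \<Phi> `` {w}) = - ends_sum (\<lambda>p. c $ Inl p) w"
    unfolding constraint_dependency_iff by blast+
  have "ends_sum (\<lambda>p. c $ Inl p) w = ends_sum (\<lambda>p. c $ Inl p) w'" if "(w, w') \<in> edge_equiv \<Phi>" for w w'
    using on[of w] on[of w'] equiv_class_eq[OF equiv_edge that] by simp
  then have const: "c $ Inl p = c $ Inl q" if "(p, q) \<in> corner_equiv \<Phi>" for p q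
    using constant_if_ends_sum_constant[of "\<lambda>p. c $ Inl p", OF _ that] by blast
  define u where "u = (\<chi> x. if x \<in> vertices \<Phi> then class_value (\<lambda>p. c $ Inl p) x else 0)"
  have u: "u $ (corner_equiv \<Phi> `` {p}) = c $ Inl p" for p
    using class_value_class[OF equiv_corner const UNIV_I] by (simp add: u_def vertices_def quotientI)
  have "c = combine_dependencies u"
  proof (rule vec_eq_iff[THEN iffD2], rule allI)
    fix k show "c $ k = combine_dependencies u $ k"
    proof (cases k)
      case (Inl p)
      then show ?thesis by (simp add: combine_dependencies_component u)
    next
      case (Inr E)
      show ?thesis
      proof (cases "E \<in> edges \<Phi>")
        case True
        then obtain w where w: "E = edge_equiv \<Phi> `` {w}" unfolding edges_def by (rule quotientE)
        show ?thesis by (simp only: Inr w combine_dependencies_component u on)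
      qed (simp add: Inr off combine_dependencies_component)
    qed
  qed
  moreover have "\<forall>x. x \<notin> vertices \<Phi> \<longrightarrow> u $ x = 0" by (simp add: u_def)
  ultimately show "c \<in> combine_dependencies ` {u. \<forall>x. x \<notin> vertices \<Phi> \<longrightarrow> u $ x = 0}" by blast
next
  fix c assume "c \<in> combine_dependencies ` {u. \<forall>x. x \<notin> vertices \<Phi> \<longrightarrow> u $ x = 0}"
  then show "c \<in> row_dependencies constraints constraint_row"
    by (auto simp: constraint_dependency_iff combine_dependencies_component)
qed

lemma dim_row_dependencies: "dim (row_dependencies constraints constraint_row) = card (vertices \<Phi>)"
proof -
  let ?U = "{u :: real ^ ('t \<times> 4) set. \<forall>x. x \<notin> vertices \<Phi> \<longrightarrow> u $ x = 0}"
  have U: "subspace ?U" by (auto simp: subspace_def)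
  have lin: "linear combine_dependencies"
    by (rule linearI) (simp_all add: combine_dependencies_def scaleR_add_left sum.distrib scaleR_sum_right)
  have "inj_on combine_dependencies ?U"
  proof (rule inj_onI)
    fix u u' assume u: "u \<in> ?U" "u' \<in> ?U" "combine_dependencies u = combine_dependencies u'"
    show "u = u'"
    proof (rule vec_eq_iff[THEN iffD2], rule allI)
      fix x show "u $ x = u' $ x"
      proof (cases "x \<in> vertices \<Phi>")
        case True
        then obtain p where "x = corner_equiv \<Phi> `` {p}" unfolding vertices_def by (rule quotientE)
        then show ?thesis using u(3) by (metis combine_dependencies_component(1))
      qed (use u in simp)
    qed
  qed
  then have "dim (combine_dependencies ` ?U) = dim ?U"
    by (intro dim_image_eq[OF lin]) (simp only: span_eq_iff[THEN iffD2, OF U])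
  also have "\<dots> = card (vertices \<Phi>)" unfolding dim_vec_eq[symmetric] by (rule dim_substandard_cart)
  finally show ?thesis by (simp only: row_dependencies_eq)
qed

text \<open>
The prescribed \<open>A\<close> and \<open>\<kappa>\<close> contribute the area-curvature functional of the link. The remaining constants,
\<open>\<pi>\<close> for each triangle and \<open>\<pi>\<close> or \<open>2 * \<pi>\<close> for each edge, contribute the Euler characteristic.
\<close>

lemma vertex_dependency_defect:
  assumes x: "x \<in> vertices \<Phi>"
  shows "(\<Sum>k\<in>constraints. vertex_dependency x $ k * constraint_rhs A \<kappa> k)
    = 2 * pi * (chi_area_curvature \<Phi> A \<kappa> (link_coord x) - real_of_int (link_euler_char \<Phi> x))"
proof -
  let ?cv = "class_value (ends_sum (corner_indicator x))"
  let ?m = "\<lambda>E. (if boundary_edge \<Phi> E then 1 else 2) :: real"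
  have 1: "(\<Sum>p\<in>UNIV. corner_indicator x p * (A p + pi)) = (\<Sum>p\<in>x. A p) + pi * real (card x)"
  proof -
    have "(\<Sum>p\<in>UNIV. corner_indicator x p * (A p + pi)) = (\<Sum>p\<in>x. A p + pi)"
      by (rule sum.mono_neutral_cong_right) (auto simp: corner_indicator_def)
    then show ?thesis by (simp add: sum.distrib)
  qed
  have 2: "(\<Sum>E\<in>edges \<Phi>. - ?cv E * constraint_rhs A \<kappa> (Inr E))
      = (\<Sum>E\<in>edges \<Phi>. ?cv E * \<kappa> E) - pi * (\<Sum>E\<in>edges \<Phi>. ?m E * ?cv E)"
    unfolding sum_distrib_left sum_subtractf[symmetric]
    by (intro sum.cong) (auto simp: constraint_rhs_def algebra_simps)
  have "(\<Sum>k\<in>constraints. vertex_dependency x $ k * constraint_rhs A \<kappa> k)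
      = (\<Sum>p\<in>UNIV. corner_indicator x p * (A p + pi)) + (\<Sum>E\<in>edges \<Phi>. - ?cv E * constraint_rhs A \<kappa> (Inr E))"
    by (simp add: sum_constraints vertex_dependency_def constraint_rhs_def)
  also have "\<dots> = ((\<Sum>p\<in>x. A p) + (\<Sum>E\<in>edges \<Phi>. ?cv E * \<kappa> E))
      - pi * ((\<Sum>E\<in>edges \<Phi>. ?m E * ?cv E) - card x)"
    unfolding 1 2 by (simp add: algebra_simps)
  also have "\<dots> = 2 * pi * (chi_area_curvature \<Phi> A \<kappa> (link_coord x) - real_of_int (link_euler_char \<Phi> x))"
    unfolding chi_area_curvature_link[OF x, symmetric] euler_char_link[OF x] by (simp add: algebra_simps)
  finally show ?thesis .
qed

lemma angle_structures_nonempty_iff: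
  "angle_structures \<Phi> A \<kappa> \<noteq> {} \<longleftrightarrow>
    (\<forall>x\<in>vertices \<Phi>. real_of_int (link_euler_char \<Phi> x) = chi_area_curvature \<Phi> A \<kappa> (link_coord x))"
proof -
  let ?pair = "\<lambda>c. \<Sum>k\<in>constraints. c $ k * constraint_rhs A \<kappa> k"
  have combine: "?pair (combine_dependencies u) = (\<Sum>x\<in>vertices \<Phi>. u $ x * ?pair (vertex_dependency x))" for u
    unfolding combine_dependencies_def
    by (simp add: sum_distrib_left sum_distrib_right mult.assoc) (rule sum.swap)
  have "angle_structures \<Phi> A \<kappa> \<noteq> {} \<longleftrightarrow> (\<forall>c\<in>row_dependencies constraints constraint_row. ?pair c = 0)"
    unfolding linear_system_solvable_iff[symmetric] angle_structures_eq by blast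
  also have "\<dots> \<longleftrightarrow> (\<forall>x\<in>vertices \<Phi>. ?pair (vertex_dependency x) = 0)"
  proof (intro iffI ballI)
    fix x assume all: "\<forall>c\<in>row_dependencies constraints constraint_row. ?pair c = 0" and x: "x \<in> vertices \<Phi>"
    have "combine_dependencies (axis x 1) \<in> row_dependencies constraints constraint_row"
      unfolding row_dependencies_eq using x by (intro imageI) (auto simp: axis_component)
    then have "?pair (combine_dependencies (axis x 1)) = 0" using all by blast
    then have "(\<Sum>y\<in>vertices \<Phi>. axis x 1 $ y * ?pair (vertex_dependency y)) = 0"
      by (simp only: combine)
    then show "?pair (vertex_dependency x) = 0"
      using x by (simp add: axis_component if_distrib[of "\<lambda>a. a * _"] cong: if_cong)
  next
    fix c assume all: "\<forall>x\<in>vertices \<Phi>. ?pair (vertex_dependency x) = 0"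
      and "c \<in> row_dependencies constraints constraint_row"
    then obtain u where "c = combine_dependencies u" unfolding row_dependencies_eq by blast
    then have "?pair c = (\<Sum>x\<in>vertices \<Phi>. u $ x * ?pair (vertex_dependency x))" by (simp only: combine)
    also have "\<dots> = 0" using all by (intro sum.neutral) simp
    finally show "?pair c = 0" .
  qed
  also have "\<dots> \<longleftrightarrow> (\<forall>x\<in>vertices \<Phi>.
      real_of_int (link_euler_char \<Phi> x) = chi_area_curvature \<Phi> A \<kappa> (link_coord x))"
    by (intro ball_cong refl) (auto simp: vertex_dependency_defect)
  finally show ?thesis .
qed

text \<open>
For the dimension: there are six wedges in each tetrahedron, four corner equations in each tetrahedron and
one equation for each edge class, and one independent dependency for each vertex, so the solutions have
dimension \<open>6 * t - (4 * t + n - v)\<close>.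
\<close>

lemma angle_structures_affine:
  assumes "angle_structures \<Phi> A \<kappa> \<noteq> {}"
  shows "affine (angle_structures \<Phi> A \<kappa>)"
    and "aff_dim (angle_structures \<Phi> A \<kappa>)
      = 2 * int CARD('t) - int (card (edges \<Phi>)) + int (card (vertices \<Phi>))"
proof -
  let ?N = "{\<theta>. \<forall>k\<in>constraints. constraint_row k \<bullet> \<theta> = 0}"
  have N: "subspace ?N" by (auto simp: subspace_def inner_add_right)
  obtain \<theta>0 where \<theta>0: "\<forall>k\<in>constraints. constraint_row k \<bullet> \<theta>0 = constraint_rhs A \<kappa> k"
    using assms unfolding angle_structures_eq by blast
  have eq: "angle_structures \<Phi> A \<kappa> = (+) \<theta>0 ` ?N"
  proof (intro equalityI subsetI)
    fix \<theta> assume "\<theta> \<in> angle_structures \<Phi> A \<kappa>"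
    then have "\<theta> - \<theta>0 \<in> ?N" using \<theta>0 by (simp add: angle_structures_eq inner_diff_right)
    then show "\<theta> \<in> (+) \<theta>0 ` ?N" by (intro image_eqI[of _ _ "\<theta> - \<theta>0"]) simp_all
  next
    fix \<theta> assume "\<theta> \<in> (+) \<theta>0 ` ?N"
    then show "\<theta> \<in> angle_structures \<Phi> A \<kappa>" using \<theta>0 by (auto simp: angle_structures_eq inner_add_right)
  qed
  show "affine (angle_structures \<Phi> A \<kappa>)"
    unfolding eq using subspace_imp_affine[OF N] by (simp add: affine_translation[symmetric])
  have "card (constraints) = 4 * CARD('t) + card (edges \<Phi>)"
    unfolding constraints_def by (subst card_Plus) simp_all
  moreover have "DIM('t angles) = 6 * CARD('t)" by (simp add: card_tedge)
  moreover have "dim ?N + card constraints = DIM('t angles) + card (vertices \<Phi>)"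
    using dim_homogeneous_solutions[of constraints constraint_row] by (simp only: dim_row_dependencies)
  moreover have "aff_dim (angle_structures \<Phi> A \<kappa>) = int (dim ?N)"
    unfolding eq by (simp only: aff_dim_translation_eq aff_dim_subspace[OF N])
  ultimately show "aff_dim (angle_structures \<Phi> A \<kappa>)
      = 2 * int CARD('t) - int (card (edges \<Phi>)) + int (card (vertices \<Phi>))" by simp
qed

end

theorem proposition16:
  fixes \<Phi> :: "('t::finite) pairing set"
    and A :: "'t \<times> 4 \<Rightarrow> real"
    and \<kappa> :: "('t \<times> tedge) set \<Rightarrow> real"
  assumes "triangulated_pseudomanifold \<Phi>"
  shows "(angle_structures \<Phi> A \<kappa> \<noteq> {} \<longleftrightarrow>
      (\<forall>x\<in>vertices \<Phi>.
        real_of_int (link_euler_char \<Phi> x) = chi_area_curvature \<Phi> A \<kappa> (link_coord x))) \<and>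
    (angle_structures \<Phi> A \<kappa> \<noteq> {} \<longrightarrow>
      affine (angle_structures \<Phi> A \<kappa>) \<and>
      aff_dim (angle_structures \<Phi> A \<kappa>) =
        2 * int CARD('t) - int (card (edges \<Phi>)) + int (card (vertices \<Phi>)))"
proof -
  interpret pseudomanifold \<Phi> using assms by (rule pseudomanifold.intro)
  show ?thesis using angle_structures_nonempty_iff angle_structures_affine by blast
qed

end
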